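(* Let $K_1,K_2$ be compact and let $\beta_1+\beta_2>0$. All suprema and limits below are over $\lambda\in\mathbb C$ with $\operatorname{Re}\lambda\ge0$. Then: (i) If $\beta_1>0$, $\beta_2>0$ and, for almost all $v''\in(0,1)$, $k_1(v'',\cdot)\in L^\infty(-1,0)$, then $c_\eta:=\sup_{|\lambda|\ge\eta}\|G_\lambda\|<1$ for every $\eta>0$. If the kernels $k_1,k_2$ of $K_1,K_2$ are continuous and $K_1|v|^{-2}K_2$ is bounded, then there exists $\widehat c>0$ such that $$\|G_\lambda\|\le1-\widehat c\,|\operatorname{Im}\lambda|^2\qquad(\lambda\to0).$$ (ii) If $\beta_1>0$, $\beta_2=0$ and, for almost all $v''\in(0,1)$, $k_1(v'',\cdot)\in L^\infty(-1,0)$, then $c_\eta:=\sup_{|\lambda|\ge\eta}\|G_\lambda^2\|<1$ for every $\eta>0$. If the kernel $k_1$ of $K_1$ is continuous and $K_1|v|^{-2}R_2K_1$ is bounded, then there exists $\widehat c>0$ such that $$\|G_\lambda^2\|\le1-\widehat c\,|\operatorname{Im}\lambda|^2\qquad(\lambda\to0).$$ (A similar statement holds if $\beta_1=0$ and $\beta_2>0$.) (iii) In particular, in both cases (i) and (ii), we have $$\sup_{|\lambda|\ge\eta}\|(1-G_\lambda)^{-1}\|<+\infty\quad(\eta>0)\qquad\text{and}\qquad\|(1-G_\lambda)^{-1}\|=O(|\operatorname{Im}\lambda|^{-2})\quad(\lambda\to0).$$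
   Context: Fix $a>0$. $R_1:L^1((-1,0);dv)\to L^1((0,1);dv)$ and $R_2:L^1((0,1);dv)\to L^1((-1,0);dv)$ are given by $(R_i\varphi)(v)=\varphi(-v)$. $K_1:L^1((-1,0);dv)\to L^1((0,1);dv)$ and $K_2:L^1((0,1);dv)\to L^1((-1,0);dv)$ are stochastic (positive and norm preserving on the positive cone) weakly compact operators; they are integral operators with kernels $k_1,k_2$: $(K_1\varphi)(v)=\int_{-1}^0k_1(v,v')\varphi(v')\,dv'$, $(K_2\varphi)(v)=\int_0^1k_2(v,v')\varphi(v')\,dv'$. Let $\alpha_i,\beta_i\ge0$ with $\alpha_i+\beta_i=1$ ($i=1,2$) and $O_i=\alpha_iR_i+\beta_iK_i$. $|v|^{-2}$ denotes multiplication by the function $|v|^{-2}$; that a product such as $K_1|v|^{-2}K_2$ "is bounded" means that it defines a bounded operator between the corresponding $L^1(dv)$ spaces. For $\operatorname{Re}\lambda\ge0$, $G_\lambda$ is the operator on $L^1((0,1);dv)$ given by $G_\lambda f=O_1\big(e^{-2\lambda a/|v|}O_2(e^{-2\lambda a/|v|}f)\big)$, where $e^{-2\lambda a/|v|}$ is a multiplication operator. $\|\cdot\|$ denotes the operator norm on $L^1((0,1);dv)$. For $\operatorname{Re}\lambda\ge0$, $\lambda\ne0$, $G_\lambda$ has spectral radius $<1$, so $(1-G_\lambda)^{-1}$ exists as a bounded operator. An estimate followed by "$(\lambda\to0)$" is meant for all $\lambda\neq0$ with $\operatorname{Re}\lambda\ge0$ in some neighbourhood of $0$. *)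

theory Defs
  imports "HOL-Analysis.Analysis" "HOL-Library.Landau_Symbols" "HOL-Library.Nonpos_Ints"
begin

text \<open>
  The complex spaces \<open>L\<^sup>1((0,1); dv)\<close> and \<open>L\<^sup>1((-1,0); dv)\<close> are the types
  \<open>pos L1\<close> and \<open>neg L1\<close>: the parameter is a phantom type that only selects the set of velocities.
\<close>

class velocity_domain =
  fixes velocities :: "'a itself \<Rightarrow> real set"
  assumes velocities_borel: "velocities TYPE('a) \<in> sets borel"

datatype pos = Pos
datatype neg = Neg

instantiation pos :: velocity_domain
begin
definition velocities_pos :: "pos itself \<Rightarrow> real set"
  where "velocities_pos _ = {0<..<1}"
instance by standard (simp add: velocities_pos_def)
end

instantiation neg :: velocity_domain
begin
definition velocities_neg :: "neg itself \<Rightarrow> real set"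
  where "velocities_neg _ = {-1<..<0}"
instance by standard (simp add: velocities_neg_def)
end

definition vmeasure :: "'d::velocity_domain itself \<Rightarrow> real measure"
  where "vmeasure d = restrict_space lborel (velocities d)"

definition L1_rel :: "'d::velocity_domain itself \<Rightarrow> (real \<Rightarrow> complex) \<Rightarrow> (real \<Rightarrow> complex) \<Rightarrow> bool"
  where "L1_rel d f g \<longleftrightarrow>
    integrable (vmeasure d) f \<and> integrable (vmeasure d) g \<and> (AE v in vmeasure d. f v = g v)"

typedef (overloaded) 'd L1 =
    "{{g. L1_rel TYPE('d::velocity_domain) f g} | f. integrable (vmeasure TYPE('d)) f}"
  by (auto intro: exI[of _ "\<lambda>_. 0"])

definition abs_L1 :: "(real \<Rightarrow> complex) \<Rightarrow> 'd::velocity_domain L1"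
  where "abs_L1 f = Abs_L1 {g. L1_rel TYPE('d) f g}"

definition rep_L1 :: "'d::velocity_domain L1 \<Rightarrow> real \<Rightarrow> complex"
  where "rep_L1 x = (SOME f. f \<in> Rep_L1 x)"

lemma L1_rel_sym: "L1_rel d f g \<Longrightarrow> L1_rel d g f"
  by (auto simp: L1_rel_def elim: AE_mp)

lemma L1_rel_trans: "L1_rel d f g \<Longrightarrow> L1_rel d g h \<Longrightarrow> L1_rel d f h"
  by (auto simp: L1_rel_def elim: AE_mp)

lemma L1_rel_refl: "integrable (vmeasure d) f \<Longrightarrow> L1_rel d f f"
  by (simp add: L1_rel_def)

lemma abs_L1_eq_iff:
  assumes "integrable (vmeasure TYPE('d::velocity_domain)) f" "integrable (vmeasure TYPE('d)) g"
  shows "(abs_L1 f :: 'd L1) = abs_L1 g \<longleftrightarrow> (AE v in vmeasure TYPE('d). f v = g v)"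
proof -
  have "(abs_L1 f :: 'd L1) = abs_L1 g \<longleftrightarrow>
      {h. L1_rel TYPE('d) f h} = {h. L1_rel TYPE('d) g h}"
    unfolding abs_L1_def by (rule Abs_L1_inject) (use assms in blast)+
  also have "\<dots> \<longleftrightarrow> L1_rel TYPE('d) f g"
    using L1_rel_refl[OF assms(2)] by (blast intro: L1_rel_sym L1_rel_trans)
  finally show ?thesis
    using assms by (simp add: L1_rel_def)
qed

lemma rep_L1_class:
  obtains f where "integrable (vmeasure TYPE('d::velocity_domain)) f"
    "x = abs_L1 f" "L1_rel TYPE('d) f (rep_L1 (x :: 'd L1))"
proof -
  obtain f where f: "integrable (vmeasure TYPE('d)) f" "Rep_L1 x = {g. L1_rel TYPE('d) f g}"
    using Rep_L1[of x] by blast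
  have "f \<in> Rep_L1 x"
    using f by (simp add: L1_rel_refl)
  then have "rep_L1 x \<in> Rep_L1 x"
    unfolding rep_L1_def by (rule someI[of "\<lambda>g. g \<in> Rep_L1 x"])
  moreover have "x = abs_L1 f"
    using f(2) by (metis Rep_L1_inverse abs_L1_def)
  ultimately show ?thesis
    using f by (intro that) auto
qed

lemma integrable_rep_L1 [simp]: "integrable (vmeasure TYPE('d)) (rep_L1 (x :: 'd::velocity_domain L1))"
  by (rule rep_L1_class[of x]) (simp add: L1_rel_def)

lemma measurable_rep_L1 [measurable, simp]:
  "rep_L1 (x :: 'd::velocity_domain L1) \<in> borel_measurable (vmeasure TYPE('d))"
  using integrable_rep_L1 by (rule borel_measurable_integrable)

lemma abs_rep_L1 [simp]: "abs_L1 (rep_L1 x) = x"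
proof (rule rep_L1_class[of x])
  fix f assume f: "integrable (vmeasure TYPE('a)) f" "x = abs_L1 f" "L1_rel TYPE('a) f (rep_L1 x)"
  have "abs_L1 f = (abs_L1 (rep_L1 x) :: 'a L1)"
    using f(3) by (subst abs_L1_eq_iff) (auto simp: L1_rel_def)
  with f(2) show ?thesis by simp
qed

lemma AE_rep_abs_L1:
  assumes "integrable (vmeasure TYPE('d)) f"
  shows "AE v in vmeasure TYPE('d). rep_L1 (abs_L1 f :: 'd::velocity_domain L1) v = f v"
  by (rule abs_L1_eq_iff[THEN iffD1]) (simp_all add: assms)

instantiation L1 :: (velocity_domain) real_normed_vector
begin

definition zero_L1 :: "'a L1"
  where "zero_L1 = abs_L1 (\<lambda>_. 0)"

definition plus_L1 :: "'a L1 \<Rightarrow> 'a L1 \<Rightarrow> 'a L1"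
  where "plus_L1 f g = abs_L1 (\<lambda>v. rep_L1 f v + rep_L1 g v)"

definition minus_L1 :: "'a L1 \<Rightarrow> 'a L1 \<Rightarrow> 'a L1"
  where "minus_L1 f g = abs_L1 (\<lambda>v. rep_L1 f v - rep_L1 g v)"

definition uminus_L1 :: "'a L1 \<Rightarrow> 'a L1"
  where "uminus_L1 f = abs_L1 (\<lambda>v. - rep_L1 f v)"

definition scaleR_L1 :: "real \<Rightarrow> 'a L1 \<Rightarrow> 'a L1"
  where "scaleR_L1 c f = abs_L1 (\<lambda>v. c *\<^sub>R rep_L1 f v)"

definition norm_L1 :: "'a L1 \<Rightarrow> real"
  where "norm_L1 f = (\<integral>v. norm (rep_L1 f v) \<partial>vmeasure TYPE('a))"

definition dist_L1 :: "'a L1 \<Rightarrow> 'a L1 \<Rightarrow> real"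
  where "dist_L1 f g = norm (f - g)"

definition sgn_L1 :: "'a L1 \<Rightarrow> 'a L1"
  where "sgn_L1 f = inverse (norm f) *\<^sub>R f"

definition uniformity_L1 :: "('a L1 \<times> 'a L1) filter"
  where "uniformity_L1 = (INF e\<in>{0<..}. principal {(f, g). dist f g < e})"

definition open_L1 :: "'a L1 set \<Rightarrow> bool"
  where "open_L1 U = (\<forall>f\<in>U. \<forall>\<^sub>F (f', g) in uniformity. f' = f \<longrightarrow> g \<in> U)"

instance
proof
  have eqI: "f = g" if "AE v in vmeasure TYPE('a). rep_L1 f v = rep_L1 g v" for f g :: "'a L1"
    using abs_L1_eq_iff[of "rep_L1 f" "rep_L1 g", where 'd = 'a] that by simp
  have zero: "AE v in vmeasure TYPE('a). rep_L1 (0 :: 'a L1) v = 0"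
    unfolding zero_L1_def by (rule AE_rep_abs_L1) simp
  have plus: "AE v in vmeasure TYPE('a). rep_L1 (f + g) v = rep_L1 f v + rep_L1 g v"
    for f g :: "'a L1"
    unfolding plus_L1_def by (rule AE_rep_abs_L1) simp
  have minus: "AE v in vmeasure TYPE('a). rep_L1 (f - g) v = rep_L1 f v - rep_L1 g v"
    for f g :: "'a L1"
    unfolding minus_L1_def by (rule AE_rep_abs_L1) simp
  have uminus: "AE v in vmeasure TYPE('a). rep_L1 (- f) v = - rep_L1 f v" for f :: "'a L1"
    unfolding uminus_L1_def by (rule AE_rep_abs_L1) simp
  have scale: "AE v in vmeasure TYPE('a). rep_L1 (c *\<^sub>R f) v = c *\<^sub>R rep_L1 f v"
    for c and f :: "'a L1"
    unfolding scaleR_L1_def by (rule AE_rep_abs_L1) simp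
  fix f g h :: "'a L1" and c d :: real
  show "f + g + h = f + (g + h)"
    by (rule eqI, use plus[of "f + g" h] plus[of f g] plus[of f "g + h"] plus[of g h] in \<open>eventually_elim, simp\<close>)
  show "f + g = g + f"
    by (rule eqI, use plus[of f g] plus[of g f] in \<open>eventually_elim, simp\<close>)
  show "0 + f = f"
    by (rule eqI, use plus[of 0 f] zero in \<open>eventually_elim, simp\<close>)
  show "- f + f = 0"
    by (rule eqI, use plus[of "- f" f] uminus[of f] zero in \<open>eventually_elim, simp\<close>)
  show "f - g = f + - g"
    by (rule eqI, use minus[of f g] plus[of f "- g"] uminus[of g] in \<open>eventually_elim, simp\<close>)
  show "c *\<^sub>R (f + g) = c *\<^sub>R f + c *\<^sub>R g"
    by (rule eqI, use scale[of c "f + g"] plus[of f g] plus[of "c *\<^sub>R f" "c *\<^sub>R g"] scale[of c f] scale[of c g] in \<open>eventually_elim, simp add: scaleR_add_right\<close>)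
  show "(c + d) *\<^sub>R f = c *\<^sub>R f + d *\<^sub>R f"
    by (rule eqI, use scale[of "c + d" f] plus[of "c *\<^sub>R f" "d *\<^sub>R f"] scale[of c f] scale[of d f] in \<open>eventually_elim, simp add: scaleR_add_left\<close>)
  show "c *\<^sub>R d *\<^sub>R f = (c * d) *\<^sub>R f"
    by (rule eqI, use scale[of c "d *\<^sub>R f"] scale[of d f] scale[of "c * d" f] in \<open>eventually_elim, simp\<close>)
  show "1 *\<^sub>R f = f"
    by (rule eqI, use scale[of 1 f] in \<open>eventually_elim, simp\<close>)
  have "norm f = 0 \<longleftrightarrow> (AE v in vmeasure TYPE('a). norm (rep_L1 f v) = 0)"
    unfolding norm_L1_def by (rule integral_nonneg_eq_0_iff_AE) simp_all
  also have "\<dots> \<longleftrightarrow> (AE v in vmeasure TYPE('a). rep_L1 f v = 0)"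
    by simp
  also have "\<dots> \<longleftrightarrow> abs_L1 (rep_L1 f) = (abs_L1 (\<lambda>_. 0) :: 'a L1)"
    by (rule abs_L1_eq_iff[symmetric]) simp_all
  finally show "norm f = 0 \<longleftrightarrow> f = 0"
    by (simp add: zero_L1_def)
  have "norm (f + g) =
      (\<integral>v. norm (rep_L1 f v + rep_L1 g v) \<partial>vmeasure TYPE('a))"
    unfolding norm_L1_def by (rule integral_cong_AE) (use plus[of f g] in auto)
  also have "\<dots> \<le> (\<integral>v. norm (rep_L1 f v) + norm (rep_L1 g v) \<partial>vmeasure TYPE('a))"
    by (intro integral_mono norm_triangle_ineq) simp_all
  also have "\<dots> = norm f + norm g"
    unfolding norm_L1_def by simp
  finally show "norm (f + g) \<le> norm f + norm g" .
  have "norm (c *\<^sub>R f) = (\<integral>v. \<bar>c\<bar> * norm (rep_L1 f v) \<partial>vmeasure TYPE('a))"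
    unfolding norm_L1_def by (rule integral_cong_AE) (use scale[of c f] in auto)
  then show "norm (c *\<^sub>R f) = \<bar>c\<bar> * norm f"
    unfolding norm_L1_def by simp
  show "dist f g = norm (f - g)"
    by (rule dist_L1_def)
  show "sgn f = inverse (norm f) *\<^sub>R f"
    by (rule sgn_L1_def)
  show "uniformity = (INF e\<in>{0<..}. principal {(f::'a L1, g). dist f g < e})"
    by (rule uniformity_L1_def)
  show "open U \<longleftrightarrow> (\<forall>f\<in>U. \<forall>\<^sub>F (f', g) in uniformity. f' = f \<longrightarrow> g \<in> U)" for U :: "'a L1 set"
    by (rule open_L1_def)
qed

end

text \<open>
  \<open>L1_mult h\<close> is multiplication by \<open>h\<close>. If \<open>h\<close> is unbounded, it is meaningful only on \<open>L1_mult_dom h\<close>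
  (\<open>abs_L1\<close> returns junk for non-integrable functions).
\<close>

definition L1_mult_dom :: "(real \<Rightarrow> complex) \<Rightarrow> 'd::velocity_domain L1 set"
  where "L1_mult_dom h = {f. integrable (vmeasure TYPE('d)) (\<lambda>v. h v * rep_L1 f v)}"

definition L1_mult :: "(real \<Rightarrow> complex) \<Rightarrow> 'd::velocity_domain L1 \<Rightarrow> 'd L1"
  where "L1_mult h f = abs_L1 (\<lambda>v. h v * rep_L1 f v)"

definition reflect :: "'d::velocity_domain L1 \<Rightarrow> 'e::velocity_domain L1"
  where "reflect f = abs_L1 (\<lambda>v. rep_L1 f (- v))"

definition L1_nonneg :: "'d::velocity_domain L1 \<Rightarrow> bool"
  where "L1_nonneg f \<longleftrightarrow> (AE v in vmeasure TYPE('d). rep_L1 f v \<in> \<real>\<^sub>\<ge>\<^sub>0)"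

definition stochastic :: "('d::velocity_domain L1 \<Rightarrow> 'e::velocity_domain L1) \<Rightarrow> bool"
  where "stochastic K \<longleftrightarrow> bounded_linear K \<and>
    (\<forall>f. L1_nonneg f \<longrightarrow> L1_nonneg (K f) \<and> norm (K f) = norm f)"

text \<open>
  \<open>bounded_linear\<close> is only real linearity; the integral representation below makes \<open>K\<close> complex linear.
\<close>

definition integral_operator ::
    "(real \<Rightarrow> real \<Rightarrow> real) \<Rightarrow> ('d::velocity_domain L1 \<Rightarrow> 'e::velocity_domain L1) \<Rightarrow> bool"
  where "integral_operator k K \<longleftrightarrow>
    (\<lambda>(v, v'). k v v') \<in> borel_measurable (vmeasure TYPE('e) \<Otimes>\<^sub>M vmeasure TYPE('d)) \<and>
    (\<forall>f. AE v in vmeasure TYPE('e).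
      integrable (vmeasure TYPE('d)) (\<lambda>v'. of_real (k v v') * rep_L1 f v') \<and>
      rep_L1 (K f) v = (\<integral>v'. of_real (k v v') * rep_L1 f v' \<partial>vmeasure TYPE('d)))"

definition weak_topology :: "'b::real_normed_vector topology"
  where "weak_topology =
    topology_generated_by {\<phi> -` U |(\<phi> :: 'b \<Rightarrow> real) U. bounded_linear \<phi> \<and> open U}"

definition weakly_compact_operator ::
    "('b::real_normed_vector \<Rightarrow> 'c::real_normed_vector) \<Rightarrow> bool"
  where "weakly_compact_operator K \<longleftrightarrow>
    bounded_linear K \<and> compactin weak_topology (weak_topology closure_of (K ` cball 0 1))"

definition compact_operator :: "('b::real_normed_vector \<Rightarrow> 'c::real_normed_vector) \<Rightarrow> bool"
  where "compact_operator K \<longleftrightarrow> bounded_linear K \<and> compact (closure (K ` cball 0 1))"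

definition ess_bounded :: "'d::velocity_domain itself \<Rightarrow> (real \<Rightarrow> real) \<Rightarrow> bool"
  where "ess_bounded d g \<longleftrightarrow>
    g \<in> borel_measurable (vmeasure d) \<and> (\<exists>C. AE v in vmeasure d. \<bar>g v\<bar> \<le> C)"

definition sections_ess_bounded ::
    "'e::velocity_domain itself \<Rightarrow> 'd::velocity_domain itself \<Rightarrow> (real \<Rightarrow> real \<Rightarrow> real) \<Rightarrow> bool"
  where "sections_ess_bounded e d k \<longleftrightarrow> (AE v in vmeasure e. ess_bounded d (k v))"

definition continuous_kernel ::
    "'e::velocity_domain itself \<Rightarrow> 'd::velocity_domain itself \<Rightarrow> (real \<Rightarrow> real \<Rightarrow> real) \<Rightarrow> bool"
  where "continuous_kernel e d k \<longleftrightarrow>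
    continuous_on (velocities e \<times> velocities d) (\<lambda>(v, v'). k v v')"

text \<open>The product \<open>A |v|\<^sup>-\<^sup>2 B\<close> is defined on the whole space and bounded.\<close>

definition inv_square_product_bounded ::
    "('e::velocity_domain L1 \<Rightarrow> 'f::velocity_domain L1) \<Rightarrow>
     ('d::velocity_domain L1 \<Rightarrow> 'e L1) \<Rightarrow> bool"
  where "inv_square_product_bounded A B \<longleftrightarrow>
    (let w = (\<lambda>v. of_real (1 / \<bar>v\<bar>\<^sup>2)) in
      range B \<subseteq> L1_mult_dom w \<and> bounded_linear (\<lambda>f. A (L1_mult w (B f))))"

definition boundary_operator ::
    "real \<Rightarrow> real \<Rightarrow> ('d::velocity_domain L1 \<Rightarrow> 'e::velocity_domain L1) \<Rightarrow> 'd L1 \<Rightarrow> 'e L1"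
  where "boundary_operator \<alpha> \<beta> K f = \<alpha> *\<^sub>R reflect f + \<beta> *\<^sub>R K f"

definition damping :: "real \<Rightarrow> complex \<Rightarrow> real \<Rightarrow> complex"
  where "damping a z v = exp (- 2 * z * of_real a / of_real \<bar>v\<bar>)"

definition G_operator ::
    "real \<Rightarrow> (neg L1 \<Rightarrow> pos L1) \<Rightarrow> (pos L1 \<Rightarrow> neg L1) \<Rightarrow> complex \<Rightarrow> pos L1 \<Rightarrow> pos L1"
  where "G_operator a O1 O2 z f =
    O1 (L1_mult (damping a z) (O2 (L1_mult (damping a z) f)))"

definition far_half_plane :: "real \<Rightarrow> complex set"
  where "far_half_plane \<eta> = {z. Re z \<ge> 0 \<and> cmod z \<ge> \<eta>}"

definition resolvent_at_1 :: "('b::real_normed_vector \<Rightarrow> 'b) \<Rightarrow> 'b \<Rightarrow> 'b"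
  where "resolvent_at_1 T = inv (\<lambda>f. f - T f)"

definition has_resolvent_at_1 :: "('b::real_normed_vector \<Rightarrow> 'b) \<Rightarrow> bool"
  where "has_resolvent_at_1 T \<longleftrightarrow> bij (\<lambda>f. f - T f) \<and> bounded_linear (resolvent_at_1 T)"

text \<open>
  A real-valued \<open>SUP\<close> is meaningful only for sets that are bounded above, hence the
  additional \<open>bdd_above\<close>.
\<close>

definition sup_norm_less_1 :: "(complex \<Rightarrow> 'b::real_normed_vector \<Rightarrow> 'b) \<Rightarrow> complex set \<Rightarrow> bool"
  where "sup_norm_less_1 T Z \<longleftrightarrow>
    bdd_above ((\<lambda>z. onorm (T z)) ` Z) \<and> (SUP z\<in>Z. onorm (T z)) < 1"

definition quadratic_gap_at_0 :: "(complex \<Rightarrow> 'b::real_normed_vector \<Rightarrow> 'b) \<Rightarrow> bool"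
  where "quadratic_gap_at_0 T \<longleftrightarrow>
    (\<exists>c>0. \<forall>\<^sub>F z in at 0 within {z. Re z \<ge> 0}. onorm (T z) \<le> 1 - c * \<bar>Im z\<bar>\<^sup>2)"

definition resolvents_bounded :: "(complex \<Rightarrow> 'b::real_normed_vector \<Rightarrow> 'b) \<Rightarrow> complex set \<Rightarrow> bool"
  where "resolvents_bounded T Z \<longleftrightarrow>
    (\<forall>z\<in>Z. has_resolvent_at_1 (T z)) \<and> bdd_above ((\<lambda>z. onorm (resolvent_at_1 (T z))) ` Z)"

text \<open>
  For real \<open>z\<close> the bound \<open>O(|Im z|\<^sup>-\<^sup>2)\<close> is void (its right-hand side is infinite), whereas
  \<open>1 / 0 = 0\<close> here; the estimate is therefore taken over \<open>Im z \<noteq> 0\<close>.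
\<close>

definition resolvent_quadratic_at_0 :: "(complex \<Rightarrow> 'b::real_normed_vector \<Rightarrow> 'b) \<Rightarrow> bool"
  where "resolvent_quadratic_at_0 T \<longleftrightarrow>
    (\<forall>\<^sub>F z in at 0 within {z. Re z \<ge> 0}. has_resolvent_at_1 (T z)) \<and>
    (\<lambda>z. onorm (resolvent_at_1 (T z)))
      \<in> O[at 0 within {z. Re z \<ge> 0 \<and> Im z \<noteq> 0}](\<lambda>z. 1 / \<bar>Im z\<bar>\<^sup>2)"

end

theory Submission
  imports Defs
begin

text \<open>
  With \<open>A = K\<^sub>1 R\<^sub>2\<close>, \<open>B = R\<^sub>1 K\<^sub>2\<close> and \<open>E\<^sub>\<lambda>\<close> the multiplication by \<open>e\<^sup>-\<^sup>2\<^sup>a\<^sup>\<lambda>\<^sup>/\<^sup>v\<close>, the operator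
  becomes \<open>G\<^sub>\<lambda> = (\<alpha>\<^sub>1 + \<beta>\<^sub>1 A) E\<^sub>\<lambda> (\<alpha>\<^sub>2 + \<beta>\<^sub>2 B) E\<^sub>\<lambda>\<close> on \<open>L\<^sup>1(0,1)\<close>, because \<open>E\<^sub>\<lambda>\<close> commutes with
  reflections (\<open>G_operator_eq\<close>). All factors are contractions and the weights are convex, so everything
  reduces to the one product in which two smoothing operators enclose a damping factor, namely
  \<open>A E\<^sub>\<lambda> B\<close> for \<open>G\<^sub>\<lambda>\<close>, and \<open>A E\<^sub>\<lambda>\<^sup>2 A\<close> or \<open>B E\<^sub>\<lambda>\<^sup>2 B\<close> for \<open>G\<^sub>\<lambda>\<^sup>2\<close>. The claim for it
  (\<open>compact_product_gap\<close>) is the single estimate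
  \<open>\<parallel>A E\<^sub>\<lambda> B\<parallel> \<le> 1 - c min(1, |\<lambda>|\<^sup>2)\<close> on the closed half plane, which contains the
  bound away from \<open>0\<close>, the quadratic bound at \<open>0\<close> and, by a Neumann series, both resolvent estimates
  (\<open>has_resolvent_at_1_of_square\<close>).

  Since norms of disjointly supported functions add up in \<open>L\<^sup>1\<close>, it is enough to estimate
  \<open>A E\<^sub>\<lambda> B f\<close> for nonnegative normalised \<open>f\<close> (\<open>bound_from_positive_cone\<close>). The functions \<open>g = B f\<close> are
  then nonnegative, normalised and relatively compact, so that a bound for a fixed \<open>g\<close>, stable
  under small perturbations, suffices (\<open>uniform_gap\<close>).

  For a fixed \<open>g\<close> and \<open>\<lambda> = i\<tau>\<close>, the Riemann--Lebesgue lemma makes \<open>A E\<^sub>\<lambda> g\<close> small for large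
  \<open>|\<tau>|\<close> (\<open>oscillation_decay\<close>). Smaller frequencies need no separate analysis: the inequality
  \<open>1 - cos 2x \<le> 4(1 - cos x)\<close> shows that the defect \<open>\<parallel>g\<parallel> - \<parallel>A E\<^sub>i\<^sub>\<tau> g\<parallel>\<close> grows at most by a factor of
  \<open>4\<close> when \<open>\<tau>\<close> is doubled (\<open>doubling\<close>), so a lower bound for large frequencies forces one of order
  \<open>\<tau>\<^sup>2\<close> for small ones. Finally the real part of \<open>\<lambda>\<close> only removes mass: it either produces a
  gap by itself or leaves \<open>g\<close> almost unchanged (\<open>damped_gap\<close>).
\<close>

section \<open>The space of integrable functions of the velocity\<close>

lemma L1_eqI:
  fixes f g :: "'d::velocity_domain L1"
  assumes "AE v in vmeasure TYPE('d). rep_L1 f v = rep_L1 g v"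
  shows "f = g"
  using abs_L1_eq_iff[of "rep_L1 f" "rep_L1 g", where 'd = 'd] assms by simp

lemma rep_L1_zero: "AE v in vmeasure TYPE('d). rep_L1 (0 :: 'd::velocity_domain L1) v = 0"
  unfolding zero_L1_def by (rule AE_rep_abs_L1) simp

lemma rep_L1_add:
  "AE v in vmeasure TYPE('d). rep_L1 (f + g :: 'd::velocity_domain L1) v = rep_L1 f v + rep_L1 g v"
  unfolding plus_L1_def by (rule AE_rep_abs_L1) simp

lemma rep_L1_diff:
  "AE v in vmeasure TYPE('d). rep_L1 (f - g :: 'd::velocity_domain L1) v = rep_L1 f v - rep_L1 g v"
  unfolding minus_L1_def by (rule AE_rep_abs_L1) simp

lemma rep_L1_scaleR:
  "AE v in vmeasure TYPE('d). rep_L1 (c *\<^sub>R f :: 'd::velocity_domain L1) v = c *\<^sub>R rep_L1 f v"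
  unfolding scaleR_L1_def by (rule AE_rep_abs_L1) simp

lemma norm_abs_L1:
  assumes "integrable (vmeasure TYPE('d)) F"
  shows "norm (abs_L1 F :: 'd::velocity_domain L1) = (\<integral>v. norm (F v) \<partial>vmeasure TYPE('d))"
  unfolding norm_L1_def
  by (rule integral_cong_AE) (use AE_rep_abs_L1[OF assms] assms in auto)

lemma dist_abs_L1:
  assumes "integrable (vmeasure TYPE('d)) F" "integrable (vmeasure TYPE('d)) G"
  shows "norm (abs_L1 F - abs_L1 G :: 'd::velocity_domain L1) =
    (\<integral>v. norm (F v - G v) \<partial>vmeasure TYPE('d))"
  unfolding norm_L1_def
  by (rule integral_cong_AE)
    (use AE_rep_abs_L1[OF assms(1)] AE_rep_abs_L1[OF assms(2)]
       rep_L1_diff[of "abs_L1 F :: 'd L1" "abs_L1 G"] assms in auto)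

text \<open>
  Completeness of \<open>L\<^sup>1\<close>, in the form needed for a Neumann series. The function \<open>\<Sum>|X\<^sub>n|\<close> has a
  finite integral, so the series converges absolutely at almost every \<open>v\<close>, and \<open>\<Sum>|X\<^sub>n|\<close>
  dominates the distance of the partial sums to the pointwise sum.
\<close>

lemma L1_summable:
  fixes X :: "nat \<Rightarrow> 'd::velocity_domain L1"
  assumes "summable (\<lambda>n. norm (X n))"
  shows "summable X"
proof -
  let ?M = "vmeasure TYPE('d)"
  let ?F = "\<lambda>n. rep_L1 (X n)"
  have sn: "summable (\<lambda>n. \<integral>v. norm (?F n v) \<partial>?M)"
    using assms by (simp add: norm_L1_def)
  have "(\<integral>\<^sup>+v. (\<Sum>n. ennreal (norm (?F n v))) \<partial>?M) = (\<Sum>n. \<integral>\<^sup>+v. ennreal (norm (?F n v)) \<partial>?M)"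
    by (rule nn_integral_suminf) simp
  also have "\<dots> = (\<Sum>n. ennreal (\<integral>v. norm (?F n v) \<partial>?M))"
    by (subst nn_integral_eq_integral) simp_all
  also have "\<dots> < \<infinity>"
    using sn by (subst suminf_ennreal2) simp_all
  finally have "AE v in ?M. (\<Sum>n. ennreal (norm (?F n v))) \<noteq> \<infinity>"
    by (intro nn_integral_noteq_infinite) auto
  then have AEs: "AE v in ?M. summable (\<lambda>n. norm (?F n v))"
    by eventually_elim (auto intro: summable_suminf_not_top)
  let ?S = "\<lambda>v. \<Sum>n. ?F n v"
  have intS: "integrable ?M ?S"
    by (rule integrable_suminf[OF _ AEs sn]) simp
  have "(\<lambda>N. \<integral>v. norm ((\<Sum>n<N. ?F n v) - ?S v) \<partial>?M) \<longlonglongrightarrow> (\<integral>v. 0 \<partial>?M)"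
  proof (rule integral_dominated_convergence)
    show "integrable ?M (\<lambda>v. \<Sum>n. norm (?F n v))"
      by (rule integrable_suminf) (use AEs sn in auto)
    show "AE v in ?M. (\<lambda>N. norm ((\<Sum>n<N. ?F n v) - ?S v)) \<longlonglongrightarrow> 0"
      using AEs
    proof eventually_elim
      case (elim v)
      then have "(\<lambda>N. \<Sum>n<N. ?F n v) \<longlonglongrightarrow> ?S v"
        by (rule summable_LIMSEQ[OF summable_norm_cancel])
      then show ?case
        by (intro tendsto_norm_zero LIM_zero)
    qed
    show "AE v in ?M. norm (norm ((\<Sum>n<N. ?F n v) - ?S v)) \<le> (\<Sum>n. norm (?F n v))" for N
      using AEs
    proof eventually_elim
      case (elim v)
      have s: "summable (\<lambda>n. ?F n v)" using elim by (rule summable_norm_cancel)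
      have "?S v = (\<Sum>n. ?F (n + N) v) + (\<Sum>n<N. ?F n v)"
        using suminf_split_initial_segment[OF s] .
      then have "norm ((\<Sum>n<N. ?F n v) - ?S v) = norm (\<Sum>n. ?F (n + N) v)"
        by (simp add: norm_minus_commute)
      also have "\<dots> \<le> (\<Sum>n. norm (?F (n + N) v))"
        using elim by (intro summable_norm) (subst summable_iff_shift)
      also have "\<dots> \<le> (\<Sum>n. norm (?F n v))"
        using suminf_split_initial_segment[OF elim, of N] by (simp add: sum_nonneg)
      finally show ?case by simp
    qed
  qed (use intS in \<open>auto\<close>)
  then have lim: "(\<lambda>N. \<integral>v. norm ((\<Sum>n<N. ?F n v) - ?S v) \<partial>?M) \<longlonglongrightarrow> 0"
    by simp
  have part: "(\<Sum>n<N. X n) = abs_L1 (\<lambda>v. \<Sum>n<N. ?F n v)" for N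
  proof (induction N)
    case 0
    then show ?case by (simp add: zero_L1_def)
  next
    case (Suc N)
    have "AE v in ?M. rep_L1 (abs_L1 (\<lambda>v. \<Sum>n<N. ?F n v) :: 'd L1) v = (\<Sum>n<N. ?F n v)"
      by (rule AE_rep_abs_L1) auto
    moreover have "AE v in ?M. rep_L1 (abs_L1 (\<lambda>v. \<Sum>n<Suc N. ?F n v) :: 'd L1) v = (\<Sum>n<Suc N. ?F n v)"
      by (rule AE_rep_abs_L1) auto
    ultimately have "AE v in ?M. rep_L1 (\<Sum>n<Suc N. X n) v = rep_L1 (abs_L1 (\<lambda>v. \<Sum>n<Suc N. ?F n v) :: 'd L1) v"
      using rep_L1_add[of "\<Sum>n<N. X n" "X N"] unfolding Suc.IH[symmetric]
      by eventually_elim simp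
    then show ?case by (rule L1_eqI)
  qed
  have "(\<lambda>N. norm ((\<Sum>n<N. X n) - abs_L1 ?S)) \<longlonglongrightarrow> 0"
    unfolding part using lim by (subst dist_abs_L1) (use intS in auto)
  then have "(\<lambda>N. \<Sum>n<N. X n) \<longlonglongrightarrow> abs_L1 ?S"
    by (rule LIM_zero_cancel[OF tendsto_norm_zero_cancel])
  then show ?thesis
    unfolding summable_def sums_def by blast
qed

text \<open>
  Pointwise description of multiplication by a bounded function. The bound is required at every
  velocity, which all multipliers below satisfy; this spares a null set in each application.
\<close>

lemma rep_L1_mult:
  fixes f :: "'d::velocity_domain L1"
  assumes [measurable]: "h \<in> borel_measurable (vmeasure TYPE('d))"
    and le: "\<And>v. v \<in> velocities TYPE('d) \<Longrightarrow> norm (h v) \<le> C"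
  shows "integrable (vmeasure TYPE('d)) (\<lambda>v. h v * rep_L1 f v)"
    and "AE v in vmeasure TYPE('d). rep_L1 (L1_mult h f) v = h v * rep_L1 f v"
    and "norm (L1_mult h f) \<le> C * norm f"
proof -
  let ?M = "vmeasure TYPE('d)"
  have sp: "space ?M = velocities TYPE('d)"
    by (simp add: vmeasure_def space_restrict_space)
  have b: "AE v in ?M. norm (h v * rep_L1 f v) \<le> norm (C * norm (rep_L1 f v))"
  proof (rule AE_I2)
    fix v assume "v \<in> space ?M"
    then have 1: "norm (h v) \<le> C" using le sp by simp
    then have "0 \<le> C" using norm_ge_zero order_trans by blast
    with 1 show "norm (h v * rep_L1 f v) \<le> norm (C * norm (rep_L1 f v))"
      by (simp add: norm_mult mult_right_mono)
  qed
  show 1: "integrable ?M (\<lambda>v. h v * rep_L1 f v)"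
    by (rule Bochner_Integration.integrable_bound[OF _ _ b]) simp_all
  show "AE v in ?M. rep_L1 (L1_mult h f) v = h v * rep_L1 f v"
    unfolding L1_mult_def by (rule AE_rep_abs_L1[OF 1])
  have "norm (L1_mult h f) = (\<integral>v. norm (h v * rep_L1 f v) \<partial>?M)"
    unfolding L1_mult_def by (rule norm_abs_L1[OF 1])
  also have "\<dots> \<le> (\<integral>v. C * norm (rep_L1 f v) \<partial>?M)"
    by (rule integral_mono[OF integrable_norm[OF 1]])
      (auto simp: sp norm_mult intro!: mult_right_mono le)
  finally show "norm (L1_mult h f) \<le> C * norm f"
    by (simp add: norm_L1_def)
qed

lemma bounded_linear_L1_mult:
  assumes [measurable]: "h \<in> borel_measurable (vmeasure TYPE('d))"
    and le: "\<And>v. v \<in> velocities TYPE('d) \<Longrightarrow> norm (h v) \<le> C"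
  shows "bounded_linear (L1_mult h :: 'd::velocity_domain L1 \<Rightarrow> 'd L1)"
proof (rule bounded_linear_intro[of _ C])
  have rep: "AE v in vmeasure TYPE('d). rep_L1 (L1_mult h f) v = h v * rep_L1 f v" for f :: "'d L1"
    by (rule rep_L1_mult(2)[OF assms(1)]) (rule le)
  fix f g :: "'d L1" and r :: real
  show "L1_mult h (f + g) = L1_mult h f + L1_mult h g"
    by (rule L1_eqI) (use rep[of "f + g"] rep[of f] rep[of g] rep_L1_add[of f g]
      rep_L1_add[of "L1_mult h f" "L1_mult h g"] in \<open>eventually_elim, simp add: distrib_left\<close>)
  show "L1_mult h (r *\<^sub>R f) = r *\<^sub>R L1_mult h f"
    by (rule L1_eqI) (use rep[of "r *\<^sub>R f"] rep[of f] rep_L1_scaleR[of r f]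
      rep_L1_scaleR[of r "L1_mult h f"] in \<open>eventually_elim, simp\<close>)
  show "norm (L1_mult h f) \<le> norm f * C"
    using rep_L1_mult(3)[OF assms(1) le, of f] by (simp add: mult.commute)
qed

section \<open>The resolvent at 1 of an operator with contractive square\<close>

text \<open>
  If \<open>T\<close> is a contraction and \<open>\<parallel>T\<^sup>2\<parallel> \<le> q < 1\<close>, then \<open>(1 - T)\<^sup>-\<^sup>1 = (1 + T) \<Sum>\<^sub>n T\<^sup>2\<^sup>n\<close>, which gives
  surjectivity of \<open>1 - T\<close>. Injectivity and the bound on the inverse come from
  \<open>f - T\<^sup>2f = (1 + T)(f - Tf)\<close>, where \<open>1 + T\<close> has norm at most \<open>2\<close>. Using the square covers both
  situations of the theorem, whether the norm of \<open>G\<^sub>\<lambda>\<close> itself or only that of its square is below \<open>1\<close>.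
\<close>

lemma has_resolvent_at_1_of_square:
  fixes T :: "'d::velocity_domain L1 \<Rightarrow> 'd L1"
  assumes T: "bounded_linear T" and le: "\<And>f. norm (T f) \<le> norm f"
    and sq: "\<And>f. norm (T (T f)) \<le> q * norm f" and q: "0 \<le> q" "q < 1"
  shows "has_resolvent_at_1 T" and "onorm (resolvent_at_1 T) \<le> 2 / (1 - q)"
proof -
  interpret T: bounded_linear T by fact
  let ?S = "\<lambda>f. f - T f"
  have S: "bounded_linear ?S"
    by (intro bounded_linear_sub bounded_linear_ident T)
  interpret S: bounded_linear ?S by fact
  have low: "norm f \<le> 2 / (1 - q) * norm (?S f)" for f
  proof -
    have "norm f - q * norm f \<le> norm f - norm (T (T f))"
      using sq by simp
    also have "\<dots> \<le> norm (f - T (T f))"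
      by (rule norm_triangle_ineq2)
    also have "f - T (T f) = ?S f + T (?S f)"
      by (simp add: T.diff)
    also have "norm \<dots> \<le> 2 * norm (?S f)"
      using norm_triangle_ineq[of "?S f" "T (?S f)"] le[of "?S f"] by linarith
    finally show ?thesis
      using q by (simp add: field_simps)
  qed
  have inj: "inj ?S"
  proof (rule injI)
    fix x y assume "?S x = ?S y"
    then have "?S (x - y) = 0" by (simp add: S.diff)
    then show "x = y" using low[of "x - y"] by simp
  qed
  have surj: "surj ?S"
  proof (rule surjI)
    fix g :: "'d L1"
    let ?P = "\<lambda>n. (T ^^ n) g"
    have b: "norm (?P (2 * n)) \<le> q ^ n * norm g" for n
    proof (induction n)
      case (Suc n)
      have "norm (?P (2 * Suc n)) \<le> q * norm (?P (2 * n))"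
        using sq[of "?P (2 * n)"] by simp
      also have "\<dots> \<le> q * (q ^ n * norm g)"
        using Suc q by (intro mult_left_mono) auto
      finally show ?case by simp
    qed simp
    have "summable (\<lambda>n. q ^ n * norm g)"
      using q by (intro summable_mult2 summable_geometric) simp
    then have "summable (\<lambda>n. norm (?P (2 * n)))"
      by (rule summable_comparison_test') (use b in auto)
    then have sm: "summable (\<lambda>n. ?P (2 * n))"
      by (rule L1_summable)
    let ?s = "\<Sum>n. ?P (2 * n)"
    have "T (T ?s) = (\<Sum>n. T (T (?P (2 * n))))"
      using sm by (simp add: T.suminf T.summable)
    also have "\<dots> = (\<Sum>n. ?P (2 * Suc n))" by simp
    also have "\<dots> = ?s - g"
      using suminf_split_head[OF sm] by simp
    finally have "T (T ?s) = ?s - g" .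
    then show "?S (?s + T ?s) = g"
      by (simp add: T.add)
  qed
  have bij: "bij ?S" using inj surj by (simp add: bij_def)
  let ?R = "resolvent_at_1 T"
  have SR: "?S (?R f) = f" for f
    unfolding resolvent_at_1_def using surj by (rule surj_f_inv_f)
  have RS: "?R (?S f) = f" for f
    unfolding resolvent_at_1_def using inj by (rule inv_f_f)
  have b: "norm (?R f) \<le> norm f * (2 / (1 - q))" for f
    using low[of "?R f"] unfolding SR by (simp add: mult.commute)
  have R: "bounded_linear ?R"
  proof (rule bounded_linear_intro[OF _ _ b])
    fix f g :: "'d L1" and r :: real
    have "?R (?S (?R f + ?R g)) = ?R f + ?R g" by (rule RS)
    then show "?R (f + g) = ?R f + ?R g" unfolding S.add SR .
    have "?R (?S (r *\<^sub>R ?R f)) = r *\<^sub>R ?R f" by (rule RS)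
    then show "?R (r *\<^sub>R f) = r *\<^sub>R ?R f" unfolding S.scaleR SR .
  qed
  then show "has_resolvent_at_1 T"
    using bij by (simp add: has_resolvent_at_1_def)
  show "onorm ?R \<le> 2 / (1 - q)"
    by (rule onorm_bound) (use b q in \<open>auto simp: mult.commute\<close>)
qed

section \<open>A Riemann--Lebesgue lemma for the phase 1/v\<close>

abbreviation vpos :: "real measure"
  where "vpos \<equiv> vmeasure TYPE(pos)"

lemma space_vpos [simp]: "space vpos = {0<..<1}"
  by (simp add: vmeasure_def space_restrict_space velocities_pos_def)

lemma integral_vpos:
  fixes f :: "real \<Rightarrow> 'b::{banach, second_countable_topology}"
  shows "(\<integral>v. f v \<partial>vpos) = (\<integral>v. indicator {0<..<1} v *\<^sub>R f v \<partial>lborel)"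
  unfolding vmeasure_def velocities_pos_def by (rule integral_restrict_space) simp

lemma emeasure_vpos: "emeasure vpos (space vpos) = 1"
  unfolding space_vpos by (simp add: vmeasure_def velocities_pos_def emeasure_restrict_space)

lemma finite_measure_vpos: "finite_measure vpos"
  by standard (simp only: emeasure_vpos, simp)

lemma sets_vpos: "A \<in> sets borel \<Longrightarrow> A \<subseteq> {0<..<1} \<Longrightarrow> A \<in> sets vpos"
  by (auto simp: vmeasure_def velocities_pos_def sets_restrict_space)

lemma sets_vpos_borel: "A \<in> sets vpos \<Longrightarrow> A \<in> sets borel"
  by (auto simp: vmeasure_def velocities_pos_def sets_restrict_space)

lemma measurable_vpos: "f \<in> borel_measurable borel \<Longrightarrow> f \<in> borel_measurable vpos"
  unfolding vmeasure_def by (rule measurable_restrict_space1) simp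

lemma norm_exp_div_le_1: "Re z \<ge> 0 \<Longrightarrow> y \<ge> 0 \<Longrightarrow> norm (exp (- z / of_real y)) \<le> 1"
  by (simp add: Re_divide_of_real divide_nonneg_nonneg)

lemma exp_div_measurable [measurable]:
  "(\<lambda>y::real. exp (- z / of_real y) :: complex) \<in> borel_measurable borel"
  by measurable

text \<open>
  Integration by parts: \<open>(y\<^sup>2 e\<^sup>-\<^sup>z\<^sup>/\<^sup>y)' = 2y e\<^sup>-\<^sup>z\<^sup>/\<^sup>y + z e\<^sup>-\<^sup>z\<^sup>/\<^sup>y\<close>. The boundary terms contribute at most \<open>2\<close>
  and the integral of \<open>2y e\<^sup>-\<^sup>z\<^sup>/\<^sup>y\<close> at most \<open>2\<close>, whence the factor \<open>4\<close>.
\<close>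

lemma norm_integral_exp_div_Icc:
  assumes z: "Re z \<ge> 0" "z \<noteq> 0" and t: "0 < e" "e \<le> t" "t \<le> 1"
  shows "norm (\<integral>y. indicator {e..t} y *\<^sub>R exp (- z / of_real y) \<partial>lborel) \<le> 4 / norm z"
proof -
  let ?E = "\<lambda>y::real. exp (- z / of_real y)"
  let ?F = "\<lambda>y::real. of_real y ^ 2 * ?E y"
  have ft: "(\<integral>y. indicator {e..t} y *\<^sub>R (2 * of_real y * ?E y + z * ?E y) \<partial>lborel) = ?F t - ?F e"
  proof (rule integral_FTC_atLeastAtMost[OF t(2)])
    fix y assume y: "e \<le> y" "y \<le> t"
    then have y0: "complex_of_real y \<noteq> 0" using t by simp
    have "((\<lambda>w. w ^ 2 * exp (- z / w)) has_field_derivative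
        (2 * of_real y * ?E y + z * ?E y)) (at (complex_of_real y))"
      by (rule derivative_eq_intros refl y0 | simp)+
        (use y0 in \<open>simp add: field_simps power2_eq_square\<close>)
    then show "(?F has_vector_derivative (2 * of_real y * ?E y + z * ?E y)) (at y within {e..t})"
      by (intro has_vector_derivative_real_field) 
  next
    show "continuous_on {e..t} (\<lambda>y. 2 * of_real y * ?E y + z * ?E y)"
      using t by (auto intro!: continuous_intros)
  qed
  have nE: "norm (?E y) \<le> 1" if "y \<in> {e..t}" for y
    using that t z by (intro norm_exp_div_le_1) auto
  have cE: "continuous_on {e..t} ?E" using t by (auto intro!: continuous_intros)
  have i1: "integrable lborel (\<lambda>y. indicator {e..t} y *\<^sub>R (2 * of_real y * ?E y))"
    by (rule borel_integrable_compact) (use t in \<open>auto intro!: continuous_intros\<close>)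
  have i2: "integrable lborel (\<lambda>y. indicator {e..t} y *\<^sub>R ?E y)"
    by (rule borel_integrable_compact[OF compact_Icc cE])
  let ?I1 = "\<integral>y. indicator {e..t} y *\<^sub>R (2 * of_real y * ?E y) \<partial>lborel"
  let ?I2 = "\<integral>y. indicator {e..t} y *\<^sub>R ?E y \<partial>lborel"
  have "?I1 + z * ?I2 =
      (\<integral>y. indicator {e..t} y *\<^sub>R (2 * of_real y * ?E y) + z * (indicator {e..t} y *\<^sub>R ?E y) \<partial>lborel)"
    by (simp only: Bochner_Integration.integral_add[OF i1 integrable_mult_right[OF i2]]
        integral_mult_right_zero)
  also have "\<dots> = ?F t - ?F e"
    unfolding ft[symmetric] by (rule Bochner_Integration.integral_cong) (auto simp: scaleR_add_right)
  finally have eq: "z * ?I2 = ?F t - ?F e - ?I1" by (simp add: algebra_simps)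
  have nF: "norm (?F y) \<le> 1" if "y \<in> {e..t}" for y
  proof -
    have "norm (?F y) = y ^ 2 * norm (?E y)" using that t by (simp add: norm_mult norm_power)
    also have "\<dots> \<le> 1 * 1"
      using that t nE[OF that] by (intro mult_mono) (auto simp: power_le_one)
    finally show ?thesis by simp
  qed
  have "norm ?I1 \<le> (\<integral>y. indicator {e..t} y * 2 \<partial>lborel)"
  proof (rule Bochner_Integration.integral_norm_bound_integral[OF i1])
    show "integrable lborel (\<lambda>y. indicator {e..t} y * (2::real))"
      using t by (intro integrable_mult_left integrable_real_indicator) auto
    fix y :: real
    show "norm (indicator {e..t} y *\<^sub>R (2 * of_real y * ?E y)) \<le> indicator {e..t} y * 2"
    proof (cases "y \<in> {e..t}")
      case True
      have "norm (2 * of_real y * ?E y) = 2 * (y * norm (?E y))" using True t by (simp add: norm_mult)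
      also have "y * norm (?E y) \<le> 1 * 1"
        using True t nE[OF True] by (intro mult_mono) auto
      finally show ?thesis using True by simp
    qed simp
  qed
  also have "\<dots> \<le> 2" using t by simp
  finally have "norm ?I1 \<le> 2" .
  moreover have "norm (?F t) \<le> 1" "norm (?F e) \<le> 1" using nF t by auto
  ultimately have "norm (z * ?I2) \<le> 4"
    unfolding eq using norm_triangle_ineq4[of "?F t - ?F e" ?I1] norm_triangle_ineq4[of "?F t" "?F e"]
    by linarith
  then show ?thesis using z by (simp add: norm_mult field_simps)
qed

text \<open>
  The bound for \<open>[e, t]\<close> does not depend on \<open>e\<close>, so it survives the limit \<open>e \<rightarrow> 0\<close>, although the
  phase is singular there.
\<close>

lemma norm_integral_exp_div_atMost:
  assumes z: "Re z \<ge> 0" "z \<noteq> 0"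
  shows "norm (\<integral>y. indicator {..t} y *\<^sub>R exp (- z / of_real y) \<partial>vpos) \<le> 4 / norm z"
proof (cases "t > 0")
  case False
  then have "(\<integral>y. indicator {..t} y *\<^sub>R exp (- z / of_real y) \<partial>vpos) = (\<integral>y. 0 \<partial>vpos)"
    by (intro Bochner_Integration.integral_cong) auto
  then show ?thesis by simp
next
  case True
  define s where "s = min t 1"
  have s: "0 < s" "s \<le> 1" using True by (auto simp: s_def)
  define E where "E = (\<lambda>y::real. exp (- z / of_real y))"
  have [measurable]: "E \<in> borel_measurable borel"
    unfolding E_def by (rule exp_div_measurable)
  show ?thesis
    unfolding E_def[symmetric, THEN fun_cong]
  proof (rule field_le_epsilon)
    fix e0 :: real assume "0 < e0"
    define e where "e = min e0 s"
    have e: "0 < e" "e \<le> s" "e \<le> e0" using \<open>0 < e0\<close> s by (auto simp: e_def)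
    have nE: "norm (E y) \<le> 1" if "0 \<le> y" for y
      unfolding E_def using that z by (intro norm_exp_div_le_1) auto
    have i1: "integrable lborel (\<lambda>y. indicator {0<..<e} y *\<^sub>R E y)"
      by (rule Bochner_Integration.integrable_bound[of _ "indicator {0<..<e} :: real \<Rightarrow> real"])
        (use nE e in \<open>auto simp: indicator_def intro!: integrable_real_indicator[unfolded indicator_def]\<close>)
    have i2: "integrable lborel (\<lambda>y. indicator {e..s} y *\<^sub>R E y)"
      unfolding E_def using e by (intro borel_integrable_compact) (auto intro!: continuous_intros)
    have "(\<integral>y. indicator {..t} y *\<^sub>R E y \<partial>vpos) =
        (\<integral>y. indicator {0<..<1} y *\<^sub>R indicator {..t} y *\<^sub>R E y \<partial>lborel)"
      by (rule integral_vpos)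
    also have "\<dots> = (\<integral>y. indicator {0<..<e} y *\<^sub>R E y + indicator {e..s} y *\<^sub>R E y \<partial>lborel)"
    proof (rule integral_cong_AE)
      \<comment> \<open>The point \<open>1\<close> is excluded: it belongs to \<open>{e..s}\<close> if \<open>t \<ge> 1\<close>, but not to \<open>{0<..<1}\<close>.\<close>
      show "AE y in lborel. indicator {0<..<1} y *\<^sub>R indicator {..t} y *\<^sub>R E y =
          indicator {0<..<e} y *\<^sub>R E y + indicator {e..s} y *\<^sub>R E y"
        using AE_lborel_singleton[of 1] 
        by eventually_elim (use e s in \<open>auto simp: indicator_def s_def split: if_splits\<close>)
    qed (measurable)
    also have "\<dots> = (\<integral>y. indicator {0<..<e} y *\<^sub>R E y \<partial>lborel) + (\<integral>y. indicator {e..s} y *\<^sub>R E y \<partial>lborel)"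
      using i1 i2 by simp
    also have "norm \<dots> \<le> e + 4 / norm z"
    proof (rule norm_triangle_le[OF add_mono])
      have "norm (\<integral>y. indicator {0<..<e} y *\<^sub>R E y \<partial>lborel) \<le> (\<integral>y. indicator {0<..<e} y \<partial>lborel)"
      proof (rule Bochner_Integration.integral_norm_bound_integral[OF i1])
        show "integrable lborel (indicat_real {0<..<e})"
          using e by (intro integrable_real_indicator) auto
      qed (use nE e in \<open>auto simp: indicator_def\<close>)
      then show "norm (\<integral>y. indicator {0<..<e} y *\<^sub>R E y \<partial>lborel) \<le> e" using e by simp
      show "norm (\<integral>y. indicator {e..s} y *\<^sub>R E y \<partial>lborel) \<le> 4 / norm z"
        unfolding E_def using z e s by (intro norm_integral_exp_div_Icc) auto
    qed
    finally show "norm (\<integral>y. indicator {..t} y *\<^sub>R E y \<partial>vpos) \<le> 4 / norm z + e0"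
      using e by simp
  qed
qed

lemma integrable_mult_exp_div:
  fixes \<phi> :: "real \<Rightarrow> complex"
  assumes "integrable vpos \<phi>" "Re z \<ge> 0"
  shows "integrable vpos (\<lambda>y. \<phi> y * exp (- z / of_real y))"
  using assms(1)
proof (rule Bochner_Integration.integrable_bound)
  show "(\<lambda>y. \<phi> y * exp (- z / of_real y)) \<in> borel_measurable vpos"
    by (rule borel_measurable_times[OF borel_measurable_integrable[OF assms(1)] measurable_vpos])
      (rule exp_div_measurable)
  show "AE y in vpos. norm (\<phi> y * exp (- z / of_real y)) \<le> norm (\<phi> y)"
    by (rule AE_I2) (use assms(2) norm_exp_div_le_1[of z] in \<open>auto simp del: norm_exp_eq_Re simp: norm_mult mult_left_le\<close>)
qed

text \<open>
  The bound of \<open>4/|z|\<close> for initial segments passes to Borel sets because the sets with vanishing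
  limit form a Dynkin system (closure under disjoint unions by Tannery's theorem, with the measures as
  dominating series), and from there to integrable functions by linearity and density.
\<close>

lemma riemann_lebesgue_exp_div:
  fixes z :: "nat \<Rightarrow> complex" and \<phi> :: "real \<Rightarrow> complex"
  assumes "integrable vpos \<phi>"
    and z: "\<And>n. Re (z n) \<ge> 0" "filterlim z at_infinity sequentially"
  shows "(\<lambda>n. \<integral>y. \<phi> y * exp (- z n / of_real y) \<partial>vpos) \<longlonglongrightarrow> 0"
  using assms(1)
proof induct
  let ?E = "\<lambda>n y. exp (- z n / complex_of_real y)"
  let ?I = "\<lambda>A n. \<integral>y. indicator A y *\<^sub>R ?E n y \<partial>vpos"
  have Eint: "integrable vpos (\<lambda>y. indicator A y *\<^sub>R ?E n y)" if "A \<in> sets borel" for A n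
  proof -
    have "integrable vpos (\<lambda>y. (1::complex))"
      using finite_measure.integrable_const[OF finite_measure_vpos] .
    from integrable_mult_exp_div[OF this z(1)] 
    have "integrable vpos (?E n)" by simp
    then have "integrable vpos (\<lambda>y. indicator (A \<inter> {0<..<1}) y *\<^sub>R ?E n y)"
      using that by (intro integrable_mult_indicator sets_vpos) auto
    then show ?thesis
      by (rule Bochner_Integration.integrable_cong[THEN iffD1, rotated 2]) (auto simp: indicator_def)
  qed
  have znz: "\<forall>\<^sub>F n in sequentially. z n \<noteq> 0"
    using z(2) unfolding filterlim_at_infinity[OF order_refl] 
    by (rule allE[of _ 1]) (auto elim: eventually_mono)
  have lim4: "(\<lambda>n. 4 / norm (z n)) \<longlonglongrightarrow> 0"
    by (rule tendsto_divide_0[OF tendsto_const])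
      (use z(2) in \<open>simp add: filterlim_at_infinity_imp_norm_at_top filterlim_at_top_imp_at_infinity\<close>)
  have atMost: "?I {..t} \<longlonglongrightarrow> 0" for t
    by (rule Lim_null_comparison[OF _ lim4])
      (use znz in \<open>eventually_elim, use norm_integral_exp_div_atMost z(1) in blast\<close>)
  have full: "?I UNIV \<longlonglongrightarrow> 0"
  proof -
    have "?I UNIV n = ?I {..1} n" for n
      by (rule Bochner_Integration.integral_cong) auto
    then show ?thesis using atMost[of 1] by simp
  qed
  have meas: "norm (?I A n) \<le> measure vpos (A \<inter> {0<..<1})" if "A \<in> sets borel" for A n
  proof -
    have sA: "A \<inter> {0<..<1} \<in> sets vpos" using that by (intro sets_vpos) auto
    have "norm (?I A n) \<le> (\<integral>y. indicator (A \<inter> {0<..<1}) y \<partial>vpos)"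
    proof (rule Bochner_Integration.integral_norm_bound_integral[OF Eint[OF that]])
      show "integrable vpos (indicat_real (A \<inter> {0<..<1}))"
        using sA finite_measure.emeasure_finite[OF finite_measure_vpos]
        by (intro integrable_real_indicator) (auto simp: less_top)
      fix y assume "y \<in> space vpos"
      then show "norm (indicator A y *\<^sub>R ?E n y) \<le> indicat_real (A \<inter> {0<..<1}) y"
        using norm_exp_div_le_1[OF z(1), of y n] 
        by (auto simp: indicator_def simp del: norm_exp_eq_Re)
    qed
    then show ?thesis using sA by simp
  qed
  have borel: "?I A \<longlonglongrightarrow> 0" if "A \<in> sets borel" for A
  proof -
    have "Int_stable (range (\<lambda>a::real. {..a}))"
      by (auto simp: Int_stable_def)
    moreover have "range (\<lambda>a::real. {..a}) \<subseteq> Pow UNIV" by simp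
    moreover have "A \<in> sigma_sets UNIV (range (\<lambda>a::real. {..a}))"
      using that by (simp add: borel_eq_atMost)
    ultimately show ?thesis
    proof (induction rule: sigma_sets_induct_disjoint)
      case (basic A)
      then show ?case using atMost by auto
    next
      case empty
      show ?case by simp
    next
      case (compl A)
      then have A: "A \<in> sets borel" by (simp add: borel_eq_atMost)
      have "?I (UNIV - A) n = ?I UNIV n - ?I A n" for n
      proof -
        have "?I UNIV n - ?I A n = (\<integral>y. indicator UNIV y *\<^sub>R ?E n y - indicator A y *\<^sub>R ?E n y \<partial>vpos)"
          by (rule Bochner_Integration.integral_diff[symmetric]) (rule Eint, use A in simp)+
        also have "\<dots> = ?I (UNIV - A) n"
          by (rule Bochner_Integration.integral_cong) (auto simp: indicator_def)
        finally show ?thesis by simp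
      qed
      then show ?case using tendsto_diff[OF full compl(2)] by simp
    next
      case (union A)
      have A: "A i \<in> sets borel" for i
        using union(2) by (auto simp add: borel_eq_atMost)
      let ?m = "\<lambda>i. measure vpos (A i \<inter> {0<..<1})"
      have sA: "range (\<lambda>i. A i \<inter> {0<..<1}) \<subseteq> sets vpos"
        using A by (auto intro: sets_vpos)
      have dj: "disjoint_family (\<lambda>i. A i \<inter> {0<..<1})"
        using union(1) by (auto simp: disjoint_family_on_def)
      have sm: "summable ?m"
        using finite_measure.finite_measure_UNION[OF finite_measure_vpos sA dj] by (rule sums_summable)
      have eq: "(\<Sum>i. ?I (A i) n) = ?I (\<Union>i. A i) n" for n
      proof -
        have sums: "(\<lambda>i. indicat_real (A i) y) sums indicator (\<Union>i. A i) y" for y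
          by (rule indicator_sums) (use union(1) in \<open>auto simp: disjoint_family_on_def\<close>)
        have s1: "(\<lambda>i. indicat_real (A i) y *\<^sub>R ?E n y) sums (indicator (\<Union>i. A i) y *\<^sub>R ?E n y)" for y
          using sums[of y] by (rule sums_scaleR_left)
        have "(\<Sum>i. ?I (A i) n) = (\<integral>y. (\<Sum>i. indicator (A i) y *\<^sub>R ?E n y) \<partial>vpos)"
        proof (rule integral_suminf[symmetric])
          show "integrable vpos (\<lambda>y. indicator (A i) y *\<^sub>R ?E n y)" for i by (rule Eint[OF A])
          show "AE y in vpos. summable (\<lambda>i. norm (indicat_real (A i) y *\<^sub>R ?E n y))"
          proof (rule AE_I2)
            fix y
            show "summable (\<lambda>i. norm (indicat_real (A i) y *\<^sub>R ?E n y))"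
              using sums_summable[OF sums[of y]] by (simp add: summable_mult2)
          qed
          show "summable (\<lambda>i. \<integral>y. norm (indicat_real (A i) y *\<^sub>R ?E n y) \<partial>vpos)"
          proof (rule summable_comparison_test'[OF sm, of 0])
            fix i
            have sAi: "A i \<inter> {0<..<1} \<in> sets vpos" using sA by auto
            have "(\<integral>y. norm (indicat_real (A i) y *\<^sub>R ?E n y) \<partial>vpos) \<le> (\<integral>y. indicator (A i \<inter> {0<..<1}) y \<partial>vpos)"
            proof (rule integral_mono[OF integrable_norm[OF Eint[OF A]]])
              show "integrable vpos (indicat_real (A i \<inter> {0<..<1}))"
                using sAi finite_measure.emeasure_finite[OF finite_measure_vpos]
                by (intro integrable_real_indicator) (auto simp: less_top)
              fix y assume "y \<in> space vpos"
              then show "norm (indicator (A i) y *\<^sub>R ?E n y) \<le> indicat_real (A i \<inter> {0<..<1}) y"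
                using norm_exp_div_le_1[OF z(1), of y n] 
                by (auto simp: indicator_def simp del: norm_exp_eq_Re)
            qed
            then show "norm (\<integral>y. norm (indicat_real (A i) y *\<^sub>R ?E n y) \<partial>vpos) \<le> ?m i"
              using sAi by simp
          qed
        qed
        also have "\<dots> = ?I (\<Union>i. A i) n"
          using sums_unique[OF s1] by simp
        finally show ?thesis .
      qed
      have "(\<lambda>n. \<Sum>i. ?I (A i) n) \<longlonglongrightarrow> (\<Sum>i. 0)"
      proof (rule tannerys_theorem[THEN conjunct2, THEN conjunct2])
        show "(\<lambda>n. ?I (A i) n) \<longlonglongrightarrow> 0" for i by (rule union(3))
        show "\<forall>\<^sub>F (i, n) in at_top \<times>\<^sub>F sequentially. norm (?I (A i) n) \<le> ?m i"
          by (rule always_eventually) (use meas[OF A] in auto)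
      qed (use sm in auto)
      then show ?case unfolding eq by simp
    qed
  qed
  {
    case (base A c)
    have "(\<lambda>n. ?I A n * c) \<longlonglongrightarrow> 0 * c"
      using base by (intro tendsto_intros borel sets_vpos_borel)
    moreover have "?I A n * c = (\<integral>y. indicator A y *\<^sub>R c * ?E n y \<partial>vpos)" for n
      by (subst integral_mult_left_zero[symmetric]) (simp add: mult.commute)
    ultimately show ?case by simp
  next
    case (add f g)
    have "(\<integral>y. (f y + g y) * ?E n y \<partial>vpos) = (\<integral>y. f y * ?E n y \<partial>vpos) + (\<integral>y. g y * ?E n y \<partial>vpos)" for n
      unfolding distrib_right
      by (rule Bochner_Integration.integral_add) (intro integrable_mult_exp_div add z)+
    then show ?case using tendsto_add[OF add(2,4)] by simp
  next
    case (lim f s)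
    have "(\<lambda>i. \<integral>y. norm (s i y - f y) \<partial>vpos) \<longlonglongrightarrow> (\<integral>y. 0 \<partial>vpos)"
    proof (rule integral_dominated_convergence)
      show "integrable vpos (\<lambda>y. 3 * norm (f y))" using lim by simp
      show "AE y in vpos. (\<lambda>i. norm (s i y - f y)) \<longlonglongrightarrow> 0"
        by (rule AE_I2) (intro tendsto_norm_zero LIM_zero lim(3))
      show "AE y in vpos. norm (norm (s i y - f y)) \<le> 3 * norm (f y)" for i
      proof (rule AE_I2)
        fix y assume "y \<in> space vpos"
        from lim(4)[OF this, of i] norm_triangle_ineq4[of "s i y" "f y"]
        show "norm (norm (s i y - f y)) \<le> 3 * norm (f y)" by simp
      qed
    qed (use lim in auto)
    then have conv: "(\<lambda>i. \<integral>y. norm (s i y - f y) \<partial>vpos) \<longlonglongrightarrow> 0" by simp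
    show ?case
    proof (rule LIMSEQ_I)
      fix r :: real assume "0 < r"
      then have "\<forall>\<^sub>F i in sequentially. (\<integral>y. norm (s i y - f y) \<partial>vpos) < r / 2"
        by (intro order_tendstoD(2)[OF conv]) simp
      then obtain i where i: "(\<integral>y. norm (s i y - f y) \<partial>vpos) < r / 2"
        by (auto simp: eventually_sequentially)
      from LIMSEQ_D[OF lim(2)[of i], of "r / 2"] \<open>0 < r\<close>
      obtain N where N: "\<And>n. n \<ge> N \<Longrightarrow> norm (\<integral>y. s i y * ?E n y \<partial>vpos) < r / 2" by auto
      show "\<exists>N. \<forall>n\<ge>N. norm ((\<integral>y. f y * ?E n y \<partial>vpos) - 0) < r"
      proof (intro exI allI impI)
        fix n assume "N \<le> n"
        have "(\<integral>y. s i y * ?E n y \<partial>vpos) - (\<integral>y. f y * ?E n y \<partial>vpos) =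
            (\<integral>y. (s i y - f y) * ?E n y \<partial>vpos)"
          unfolding left_diff_distrib
          by (rule Bochner_Integration.integral_diff[symmetric]) (intro integrable_mult_exp_div lim z)+
        also have "norm \<dots> \<le> (\<integral>y. norm (s i y - f y) \<partial>vpos)"
        proof (rule Bochner_Integration.integral_norm_bound_integral)
          fix y assume "y \<in> space vpos"
          then show "norm ((s i y - f y) * ?E n y) \<le> norm (s i y - f y)"
            using norm_exp_div_le_1[OF z(1), of y n] by (auto simp: norm_mult mult_left_le simp del: norm_exp_eq_Re)
        qed (intro integrable_mult_exp_div integrable_norm Bochner_Integration.integrable_diff lim z)+
        finally show "norm ((\<integral>y. f y * ?E n y \<partial>vpos) - 0) < r"
          using i N[OF \<open>N \<le> n\<close>] norm_triangle_ineq3[of "\<integral>y. s i y * ?E n y \<partial>vpos" "\<integral>y. f y * ?E n y \<partial>vpos"]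
          unfolding diff_zero by linarith
      qed
    qed
  }
qed

section \<open>Stochastic integral operators on L1(0,1)\<close>

text \<open>
  The sections of the kernel are required to be measurable at every point: the integral of
  \<open>k v w * rep_L1 f w\<close> then does not change if the representative of \<open>f\<close> is modified on a null set,
  which could otherwise destroy measurability, as Lebesgue measure is not complete on the Borel sets.
\<close>

definition represents :: "(real \<Rightarrow> real \<Rightarrow> real) \<Rightarrow> (pos L1 \<Rightarrow> pos L1) \<Rightarrow> bool"
  where "represents k A \<longleftrightarrow> (\<forall>v\<in>{0<..<1}. k v \<in> borel_measurable vpos) \<and>
    (\<forall>f. AE v in vpos. integrable vpos (\<lambda>w. of_real (k v w) * rep_L1 f w) \<and>
      rep_L1 (A f) v = (\<integral>w. of_real (k v w) * rep_L1 f w \<partial>vpos))"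

lemma rep_L1_nonneg: 
  assumes "L1_nonneg (f :: 'd::velocity_domain L1)"
  shows "AE v in vmeasure TYPE('d). rep_L1 f v = of_real (norm (rep_L1 f v))"
  using assms unfolding L1_nonneg_def
  by eventually_elim (auto simp: complex_nonneg_Reals_iff complex_eq_iff cmod_eq_Re)

lemma exists_angle: "\<exists>\<theta>. cis \<theta> * z = - of_real (norm z)"
proof -
  have "cis (pi - Arg z) * z = cis (pi - Arg z) * (of_real (norm z) * cis (Arg z))"
    using rcis_cmod_Arg[of z] by (simp add: rcis_def)
  also have "\<dots> = of_real (norm z) * cis ((pi - Arg z) + Arg z)"
    by (simp only: cis_mult[symmetric] ac_simps)
  also have "\<dots> = - of_real (norm z)" by simp
  finally show ?thesis by blast
qed

locale stochastic_kernel =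
  fixes A :: "pos L1 \<Rightarrow> pos L1" and k :: "real \<Rightarrow> real \<Rightarrow> real"
  assumes stochastic: "stochastic A" and represents: "represents k A"
begin

lemma linear: "bounded_linear A"
  using stochastic by (simp add: stochastic_def)

lemma norm_nonneg: "L1_nonneg f \<Longrightarrow> norm (A f) = norm f"
  using stochastic by (simp add: stochastic_def)

lemma nonneg: "L1_nonneg f \<Longrightarrow> L1_nonneg (A f)"
  using stochastic by (simp add: stochastic_def)

lemma kernel_measurable: "v \<in> {0<..<1} \<Longrightarrow> k v \<in> borel_measurable vpos"
  using represents by (simp add: represents_def)

lemma kernel:
  "AE v in vpos. v \<in> {0<..<1} \<and> integrable vpos (\<lambda>w. of_real (k v w) * rep_L1 f w) \<and>
      rep_L1 (A f) v = (\<integral>w. of_real (k v w) * rep_L1 f w \<partial>vpos)"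
  using represents AE_space[of vpos] by (auto simp: represents_def)

text \<open>
  For a fixed angle this is positivity of \<open>A\<close>, applied to the real part of
  \<open>h + e\<^sup>i\<^sup>\<theta> f + e\<^sup>2\<^sup>i\<^sup>\<theta> g\<close>, because the kernel is real. A single null set serves all rational
  angles, and by continuity in \<open>\<theta>\<close> it serves all angles. In the conclusion \<open>\<theta>\<close> may therefore be
  chosen depending on \<open>v\<close>; this is what replaces the positivity of the kernel function.
\<close>

lemma trig_positivity:
  assumes pos: "AE v in vpos. \<forall>\<theta>.
      0 \<le> Re (rep_L1 h v) + Re (cis \<theta> * rep_L1 f v) + Re (cis (2 * \<theta>) * rep_L1 g v)"
  shows "AE v in vpos. \<forall>\<theta>.
      0 \<le> Re (rep_L1 (A h) v) + Re (cis \<theta> * rep_L1 (A f) v) + Re (cis (2 * \<theta>) * rep_L1 (A g) v)"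
proof -
  have fixed: "AE v in vpos. 0 \<le> Re (rep_L1 (A h) v) + Re (cis \<theta> * rep_L1 (A f) v) + Re (cis (2 * \<theta>) * rep_L1 (A g) v)"
    for \<theta>
  proof -
    let ?P = "\<lambda>v. rep_L1 h v + cis \<theta> * rep_L1 f v + cis (2 * \<theta>) * rep_L1 g v"
    have int: "integrable vpos ?P" by simp
    define p :: "pos L1" where "p = abs_L1 (\<lambda>v. of_real (Re (?P v)))"
    have intR: "integrable vpos (\<lambda>v. complex_of_real (Re (?P v)))"
      by (rule integrable_of_real[OF integrable_Re[OF int]])
    have rep: "AE v in vpos. rep_L1 p v = of_real (Re (?P v))"
      unfolding p_def by (rule AE_rep_abs_L1[OF intR])
    have "L1_nonneg p"
      unfolding L1_nonneg_def using rep pos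
      by eventually_elim (simp add: complex_nonneg_Reals_iff)
    from nonneg[OF this] have "AE v in vpos. 0 \<le> Re (rep_L1 (A p) v)"
      unfolding L1_nonneg_def by (auto simp: complex_nonneg_Reals_iff)
    then show ?thesis
      using kernel[of p] kernel[of h] kernel[of f] kernel[of g]
    proof eventually_elim
      case (elim v)
      let ?k = "\<lambda>w. complex_of_real (k v w)"
      have [measurable]: "k v \<in> borel_measurable vpos"
        using elim by (intro kernel_measurable) auto
      have i: "integrable vpos (\<lambda>w. ?k w * rep_L1 h w)"
          "integrable vpos (\<lambda>w. cis \<theta> * (?k w * rep_L1 f w))"
          "integrable vpos (\<lambda>w. cis (2 * \<theta>) * (?k w * rep_L1 g w))"
        using elim by auto
      have eq: "?k w * ?P w = ?k w * rep_L1 h w + cis \<theta> * (?k w * rep_L1 f w) + cis (2 * \<theta>) * (?k w * rep_L1 g w)" for w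
        by (simp add: algebra_simps)
      have ikP: "integrable vpos (\<lambda>w. ?k w * ?P w)"
        unfolding eq using i by simp
      have "rep_L1 (A h) v + cis \<theta> * rep_L1 (A f) v + cis (2 * \<theta>) * rep_L1 (A g) v = (\<integral>w. ?k w * ?P w \<partial>vpos)"
        unfolding eq using i elim by simp
      then have "Re (rep_L1 (A h) v + cis \<theta> * rep_L1 (A f) v + cis (2 * \<theta>) * rep_L1 (A g) v) = (\<integral>w. Re (?k w * ?P w) \<partial>vpos)"
        using integral_Re[OF ikP] by simp
      also have "\<dots> = Re (\<integral>w. of_real (Re (?k w * ?P w)) \<partial>vpos)"
        by (simp only: integral_complex_of_real Re_complex_of_real)
      also have "(\<integral>w. of_real (Re (?k w * ?P w)) \<partial>vpos) = (\<integral>w. ?k w * rep_L1 p w \<partial>vpos)"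
        by (rule integral_cong_AE, measurable) (use rep in \<open>eventually_elim, simp\<close>)
      also have "\<dots> = rep_L1 (A p) v" using elim by simp
      finally show ?case using elim by simp
    qed
  qed
  have "AE v in vpos. \<forall>\<theta>\<in>\<rat>. 0 \<le> Re (rep_L1 (A h) v) + Re (cis \<theta> * rep_L1 (A f) v) + Re (cis (2 * \<theta>) * rep_L1 (A g) v)"
    by (rule AE_ball_countable'[OF fixed countable_rat])
  then show ?thesis
  proof eventually_elim
    case (elim v)
    let ?\<phi> = "\<lambda>\<theta>. Re (rep_L1 (A h) v) + Re (cis \<theta> * rep_L1 (A f) v) + Re (cis (2 * \<theta>) * rep_L1 (A g) v)"
    have "closed {\<theta>. 0 \<le> ?\<phi> \<theta>}"
      by (intro closed_Collect_le continuous_intros)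
    moreover have "\<rat> \<subseteq> {\<theta>. 0 \<le> ?\<phi> \<theta>}" using elim by auto
    ultimately have "closure \<rat> \<subseteq> {\<theta>. 0 \<le> ?\<phi> \<theta>}" by (rule closure_minimal[rotated])
    then show ?case by (auto simp: Rats_closure_real)
  qed
qed

text \<open>
  The instance \<open>g = 0\<close> of trigonometric positivity, with \<open>\<theta>\<close> chosen so that it rotates the value of
  \<open>A f\<close> onto the negative real axis.
\<close>

lemma domination:
  assumes le: "AE v in vpos. norm (rep_L1 f v) \<le> Re (rep_L1 h v)"
  shows "AE v in vpos. norm (rep_L1 (A f) v) \<le> Re (rep_L1 (A h) v)"
proof -
  have "AE v in vpos. \<forall>\<theta>. 0 \<le> Re (rep_L1 h v) + Re (cis \<theta> * rep_L1 f v) + Re (cis (2 * \<theta>) * rep_L1 (0 :: pos L1) v)"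
    using le rep_L1_zero[where 'd=pos]
  proof eventually_elim
    case (elim v)
    have "\<bar>Re (cis \<theta> * rep_L1 f v)\<bar> \<le> norm (rep_L1 f v)" for \<theta>
      using abs_Re_le_cmod[of "cis \<theta> * rep_L1 f v"] by (simp add: norm_mult)
    then have "0 \<le> Re (rep_L1 h v) + Re (cis \<theta> * rep_L1 f v)" for \<theta>
      using elim(1) by (smt (verit))
    then show ?case using elim(2) by simp
  qed
  from trig_positivity[OF this] show ?thesis
    using rep_L1_zero[where 'd=pos]
  proof eventually_elim
    case (elim v)
    have "A 0 = 0" using linear by (rule bounded_linear.linear[THEN linear_0])
    then have *: "0 \<le> Re (rep_L1 (A h) v) + Re (cis \<theta> * rep_L1 (A f) v)" for \<theta>
      using elim(1)[rule_format, of \<theta>] elim(2) by simp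
    obtain \<theta> where "cis \<theta> * rep_L1 (A f) v = - of_real (norm (rep_L1 (A f) v))"
      using exists_angle by blast
    with *[of \<theta>] show ?case by simp
  qed
qed

lemma norm_le: "norm (A f) \<le> norm f"
proof -
  define h :: "pos L1" where "h = abs_L1 (\<lambda>v. of_real (norm (rep_L1 f v)))"
  have int: "integrable vpos (\<lambda>v. complex_of_real (norm (rep_L1 f v)))" by simp
  have rep: "AE v in vpos. rep_L1 h v = of_real (norm (rep_L1 f v))"
    unfolding h_def by (rule AE_rep_abs_L1[OF int])
  have nh: "L1_nonneg h"
    unfolding L1_nonneg_def using rep by eventually_elim simp
  have "AE v in vpos. norm (rep_L1 (A f) v) \<le> Re (rep_L1 (A h) v)"
    by (rule domination) (use rep in \<open>eventually_elim, simp\<close>)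
  then have "AE v in vpos. norm (rep_L1 (A f) v) \<le> norm (rep_L1 (A h) v)"
    by eventually_elim (use complex_Re_le_cmod order_trans in blast)
  then have "norm (A f) \<le> norm (A h)"
    unfolding norm_L1_def by (intro integral_mono_AE) simp_all
  also have "\<dots> = norm h" by (rule norm_nonneg[OF nh])
  also have "\<dots> = norm f"
    unfolding h_def by (subst norm_abs_L1[OF int]) (simp add: norm_L1_def)
  finally show ?thesis .
qed

text \<open>
  The mass lost by cancellation of the phases \<open>e\<^sup>2\<^sup>i\<^sup>x\<close> is at most four times the mass lost with \<open>e\<^sup>i\<^sup>x\<close>,
  because \<open>1 - cos 2x \<le> 4(1 - cos x)\<close>. At each \<open>v\<close> the angle \<open>x\<close> is measured from the phase
  for which \<open>A (e f)\<close> has its full modulus. The pointwise inequality is \<open>3 + 4 cos x + cos 2x \<ge> 0\<close>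
  after a shift of \<open>x\<close> by \<open>\<pi>\<close>.
\<close>

lemma doubling:
  assumes f: "L1_nonneg f" and [measurable]: "e \<in> borel_measurable vpos"
    and e: "\<And>v. v \<in> {0<..<1} \<Longrightarrow> norm (e v) = 1"
  shows "norm f - norm (A (L1_mult (\<lambda>v. e v ^ 2) f)) \<le> 4 * (norm f - norm (A (L1_mult e f)))"
proof -
  let ?f1 = "L1_mult e f" and ?f2 = "L1_mult (\<lambda>v. e v ^ 2) f"
  have r1: "AE v in vpos. rep_L1 ?f1 v = e v * rep_L1 f v"
    by (rule rep_L1_mult(2)[where C=1]) (auto simp: velocities_pos_def e)
  have r2: "AE v in vpos. rep_L1 ?f2 v = e v ^ 2 * rep_L1 f v"
    by (rule rep_L1_mult(2)[where C=1]) (auto simp: velocities_pos_def e norm_power)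
  have "AE v in vpos. \<forall>\<theta>. 0 \<le> Re (rep_L1 (3 *\<^sub>R f) v) + Re (cis \<theta> * rep_L1 (4 *\<^sub>R ?f1) v) + Re (cis (2 * \<theta>) * rep_L1 ?f2 v)"
    using r1 r2 rep_L1_nonneg[OF f] rep_L1_scaleR[of 3 f] rep_L1_scaleR[of 4 ?f1] AE_space
  proof eventually_elim
    case (elim v)
    show ?case
    proof
      fix \<theta>
      let ?u = "cis \<theta> * e v"
      have "norm ?u = 1" using e elim(6) by (simp add: norm_mult)
      then have u: "Re ?u ^ 2 + Im ?u ^ 2 = 1" by (metis cmod_power2 one_power2)
      have "Re (?u ^ 2) = Re ?u ^ 2 - Im ?u ^ 2" by (simp add: power2_eq_square)
      with u have "3 + 4 * Re ?u + Re (?u ^ 2) = 2 * (1 + Re ?u) ^ 2"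
        by (simp add: power2_eq_square algebra_simps)
      then have "0 \<le> 3 + 4 * Re ?u + Re (?u ^ 2)" by simp
      then have "0 \<le> norm (rep_L1 f v) * (3 + 4 * Re ?u + Re (?u ^ 2))" by simp
      also have "\<dots> = Re (of_real (norm (rep_L1 f v)) * (3 + 4 * ?u + ?u ^ 2))" by simp
      also have "of_real (norm (rep_L1 f v)) * (3 + 4 * ?u + ?u ^ 2) =
          3 *\<^sub>R rep_L1 f v + cis \<theta> * (4 *\<^sub>R (e v * rep_L1 f v)) + cis (2 * \<theta>) * (e v ^ 2 * rep_L1 f v)"
      proof -
        have c2: "cis (2 * \<theta>) = cis \<theta> ^ 2" by (simp add: power2_eq_square cis_mult)
        show ?thesis unfolding c2 elim(3)[symmetric]
          by (simp add: scaleR_conv_of_real power_mult_distrib algebra_simps)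
      qed
      finally show "0 \<le> Re (rep_L1 (3 *\<^sub>R f) v) + Re (cis \<theta> * rep_L1 (4 *\<^sub>R ?f1) v) + Re (cis (2 * \<theta>) * rep_L1 ?f2 v)"
        unfolding elim(1,2,4,5) plus_complex.sel .
    qed
  qed
  note pos = trig_positivity[OF this]
  interpret A: bounded_linear A by (rule linear)
  have "AE v in vpos. 4 * norm (rep_L1 (A ?f1) v) \<le> 3 * norm (rep_L1 (A f) v) + norm (rep_L1 (A ?f2) v)"
    using pos rep_L1_scaleR[of 3 "A f"] rep_L1_scaleR[of 4 "A ?f1"]
  proof eventually_elim
    case (elim v)
    \<comment> \<open>The angle depends on \<open>v\<close>, which is legitimate since the null set does not depend on the angle.\<close>
    obtain \<theta> where \<theta>: "cis \<theta> * rep_L1 (A ?f1) v = - of_real (norm (rep_L1 (A ?f1) v))"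
      using exists_angle by blast
    have "0 \<le> Re (3 *\<^sub>R rep_L1 (A f) v) + Re (4 *\<^sub>R (cis \<theta> * rep_L1 (A ?f1) v)) + Re (cis (2 * \<theta>) * rep_L1 (A ?f2) v)"
      using elim(1)[rule_format, of \<theta>] elim(2,3) by (simp add: A.scaleR)
    moreover have "Re (cis (2 * \<theta>) * rep_L1 (A ?f2) v) \<le> norm (rep_L1 (A ?f2) v)"
      using complex_Re_le_cmod[of "cis (2 * \<theta>) * rep_L1 (A ?f2) v"] by (simp add: norm_mult)
    moreover have "Re (rep_L1 (A f) v) \<le> norm (rep_L1 (A f) v)" by (rule complex_Re_le_cmod)
    ultimately show ?case unfolding \<theta> by simp
  qed
  then have "(\<integral>v. 4 * norm (rep_L1 (A ?f1) v) \<partial>vpos) \<le> (\<integral>v. 3 * norm (rep_L1 (A f) v) + norm (rep_L1 (A ?f2) v) \<partial>vpos)"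
    by (intro integral_mono_AE) simp_all
  then have "4 * norm (A ?f1) \<le> 3 * norm (A f) + norm (A ?f2)"
    by (simp add: norm_L1_def)
  then show ?thesis using norm_nonneg[OF f] by simp
qed

text \<open>
  For almost every \<open>v\<close> the function \<open>w \<mapsto> k v w * f w\<close> is integrable, so the Riemann--Lebesgue lemma
  gives pointwise decay; \<open>A |f|\<close> dominates.
\<close>

lemma oscillation_decay:
  fixes f :: "pos L1"
  assumes z: "\<And>n. Re (z n) \<ge> 0" "filterlim z at_infinity sequentially"
  shows "(\<lambda>n. norm (A (L1_mult (\<lambda>v. exp (- z n / of_real v)) f))) \<longlonglongrightarrow> 0"
proof -
  let ?e = "\<lambda>n v. exp (- z n / of_real v)"
  have m: "?e n \<in> borel_measurable vpos" for n
    by (rule measurable_vpos) (rule exp_div_measurable)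
  have b: "norm (?e n v) \<le> 1" if "v \<in> velocities TYPE(pos)" for n v
    using that by (intro norm_exp_div_le_1 z) (auto simp: velocities_pos_def)
  have rep: "AE v in vpos. rep_L1 (L1_mult (?e n) f) v = ?e n v * rep_L1 f v" for n
    by (rule rep_L1_mult(2)[OF m b])
  define h :: "pos L1" where "h = abs_L1 (\<lambda>v. of_real (norm (rep_L1 f v)))"
  have reph: "AE v in vpos. rep_L1 h v = of_real (norm (rep_L1 f v))"
    unfolding h_def by (rule AE_rep_abs_L1) simp
  have "(\<lambda>n. \<integral>v. norm (rep_L1 (A (L1_mult (?e n) f)) v) \<partial>vpos) \<longlonglongrightarrow> (\<integral>v. 0 \<partial>vpos)"
  proof (rule integral_dominated_convergence)
    show "integrable vpos (\<lambda>v. Re (rep_L1 (A h) v))" by (intro integrable_Re) simp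
    have "AE v in vpos. \<forall>n. rep_L1 (A (L1_mult (?e n) f)) v = (\<integral>w. of_real (k v w) * rep_L1 (L1_mult (?e n) f) w \<partial>vpos)"
      unfolding AE_all_countable using kernel by auto
    moreover have "AE v in vpos. v \<in> {0<..<1} \<and> integrable vpos (\<lambda>w. of_real (k v w) * rep_L1 f w)"
      using kernel[of f] by auto
    ultimately show "AE v in vpos. (\<lambda>n. norm (rep_L1 (A (L1_mult (?e n) f)) v)) \<longlonglongrightarrow> 0"
    proof eventually_elim
      case (elim v)
      have [measurable]: "k v \<in> borel_measurable vpos"
        using elim by (intro kernel_measurable) auto
      have eq: "rep_L1 (A (L1_mult (?e n) f)) v = (\<integral>w. (of_real (k v w) * rep_L1 f w) * ?e n w \<partial>vpos)" for n
      proof -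
        have "(\<integral>w. of_real (k v w) * rep_L1 (L1_mult (?e n) f) w \<partial>vpos) = (\<integral>w. (of_real (k v w) * rep_L1 f w) * ?e n w \<partial>vpos)"
        proof (rule integral_cong_AE)
          note [measurable] = m
          show "(\<lambda>w. of_real (k v w) * rep_L1 (L1_mult (?e n) f) w) \<in> borel_measurable vpos" by measurable
          show "(\<lambda>w. (of_real (k v w) * rep_L1 f w) * ?e n w) \<in> borel_measurable vpos"
            by (intro borel_measurable_times m) measurable
          show "AE w in vpos. of_real (k v w) * rep_L1 (L1_mult (?e n) f) w = (of_real (k v w) * rep_L1 f w) * ?e n w"
            using rep[of n] by eventually_elim simp
        qed
        then show ?thesis using elim by simp
      qed
      have "integrable vpos (\<lambda>w. of_real (k v w) * rep_L1 f w)" using elim by simp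
      from riemann_lebesgue_exp_div[OF this z] show ?case
        unfolding eq by (rule tendsto_norm_zero)
    qed
    show "AE v in vpos. norm (norm (rep_L1 (A (L1_mult (?e n) f)) v)) \<le> Re (rep_L1 (A h) v)" for n
    proof -
      have "AE v in vpos. norm (rep_L1 (L1_mult (?e n) f) v) \<le> Re (rep_L1 h v)"
        using rep[of n] reph AE_space
      proof eventually_elim
        case (elim v)
        have "norm (?e n v) * norm (rep_L1 f v) \<le> 1 * norm (rep_L1 f v)"
          using elim(3) b[of v n] by (intro mult_right_mono) (auto simp: velocities_pos_def)
        then show ?case unfolding elim(1,2) by (simp only: norm_mult Re_complex_of_real mult_1)
      qed
      from domination[OF this] show ?thesis by simp
    qed
  qed simp_all
  then show ?thesis by (simp add: norm_L1_def)
qed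

text \<open>
  Boundedness of \<open>A\<close> only comprises real linearity; complex homogeneity is due to the kernel.
\<close>

lemma complex_homogeneous: "A (L1_mult (\<lambda>_. c) f) = L1_mult (\<lambda>_. c) (A f)"
proof (rule L1_eqI)
  have rep: "AE v in vpos. rep_L1 (L1_mult (\<lambda>_. c) g) v = c * rep_L1 g v" for g :: "pos L1"
    by (rule rep_L1_mult(2)[where C="norm c"]) auto
  show "AE v in vpos. rep_L1 (A (L1_mult (\<lambda>_. c) f)) v = rep_L1 (L1_mult (\<lambda>_. c) (A f)) v"
    using kernel[of f] kernel[of "L1_mult (\<lambda>_. c) f"] rep[of "A f"]
  proof eventually_elim
    case (elim v)
    have [measurable]: "k v \<in> borel_measurable vpos"
      using elim by (intro kernel_measurable) auto
    have "(\<integral>w. of_real (k v w) * rep_L1 (L1_mult (\<lambda>_. c) f) w \<partial>vpos) = (\<integral>w. c * (of_real (k v w) * rep_L1 f w) \<partial>vpos)"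
      by (rule integral_cong_AE, measurable) (use rep[of f] in \<open>eventually_elim, simp\<close>)
    then show ?case using elim by simp
  qed
qed

end

section \<open>The gap on a compact set of nonnegative functions\<close>

definition osc :: "real \<Rightarrow> real \<Rightarrow> complex"
  where "osc t v = exp (- (\<i> * of_real t) / of_real v)"

lemma osc_measurable: "osc t \<in> borel_measurable vpos"
  unfolding osc_def[abs_def] by (rule measurable_vpos) (rule exp_div_measurable)

lemma norm_osc [simp]: "norm (osc t v) = 1"
  by (simp add: osc_def Re_divide_of_real)

lemma osc_double: "osc (2 * t) v = osc t v ^ 2"
  unfolding osc_def by (simp add: exp_double[symmetric] algebra_simps)

text \<open>
  Doubling a frequency raises \<open>\<gamma>\<close> at most fourfold, which is how \<open>t\<^sup>2\<close> grows. A lower bound beyond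
  the threshold \<open>T\<close> hence propagates down to small frequencies with exactly quadratic loss.
\<close>

lemma doubling_lower_bound:
  fixes \<gamma> :: "real \<Rightarrow> real"
  assumes double: "\<And>t. \<gamma> (2 * t) \<le> 4 * \<gamma> t" and nonneg: "\<And>t. 0 \<le> \<gamma> t"
    and far: "\<And>t. T \<le> \<bar>t\<bar> \<Longrightarrow> \<delta> \<le> \<gamma> t" and T: "0 < T" and \<delta>: "0 \<le> \<delta>"
  shows "\<delta> * min 1 ((t / (2 * T))\<^sup>2) \<le> \<gamma> t"
proof (cases "t = 0")
  case True
  then show ?thesis using nonneg by simp
next
  case False
  have "\<delta> * min 1 ((t / (2 * T))\<^sup>2) \<le> \<gamma> t" if "T \<le> 2 ^ n * \<bar>t\<bar>" for n t
    using that
  proof (induction n arbitrary: t)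
    case 0
    have "\<delta> * min 1 ((t / (2 * T))\<^sup>2) \<le> \<delta> * 1" using \<delta> by (intro mult_left_mono) auto
    then show ?case using far[of t] 0 by simp
  next
    case (Suc n)
    show ?case
    proof (cases "T \<le> \<bar>t\<bar>")
      case True
      have "\<delta> * min 1 ((t / (2 * T))\<^sup>2) \<le> \<delta> * 1" using \<delta> by (intro mult_left_mono) auto
      then show ?thesis using far[of t] True by simp
    next
      case False
      have "\<bar>t / T\<bar> \<le> 1" using False T by simp
      then have le1: "(t / T)\<^sup>2 \<le> 1" using abs_le_square_iff[of "t / T" 1] by simp
      \<comment> \<open>Below the threshold the minimum in the bound at \<open>2t\<close> is attained by the quadratic term.\<close>
      have "\<delta> * min 1 ((2 * t / (2 * T))\<^sup>2) \<le> \<gamma> (2 * t)"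
        by (rule Suc.IH) (use Suc.prems in \<open>simp add: abs_mult\<close>)
      then have "\<delta> * (t / T)\<^sup>2 \<le> 4 * \<gamma> t"
        using double[of t] le1 by simp
      then have "\<delta> * (t / (2 * T))\<^sup>2 \<le> \<gamma> t" by (simp add: power_divide power_mult_distrib)
      moreover have "\<delta> * min 1 ((t / (2 * T))\<^sup>2) \<le> \<delta> * (t / (2 * T))\<^sup>2"
        using \<delta> by (intro mult_left_mono) auto
      ultimately show ?thesis by simp
    qed
  qed
  moreover obtain n where "T / \<bar>t\<bar> < 2 ^ n"
    using real_arch_pow[of 2 "T / \<bar>t\<bar>"] by auto
  then have "T \<le> 2 ^ n * \<bar>t\<bar>" using False by (simp add: field_simps)
  ultimately show ?thesis by blast
qed

context stochastic_kernel
begin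

lemma frequency_threshold:
  obtains T where "0 < T" "\<And>t. T \<le> \<bar>t\<bar> \<Longrightarrow> norm (A (L1_mult (osc t) f)) \<le> 1 / 4"
proof -
  have "\<exists>T>0. \<forall>t. T \<le> \<bar>t\<bar> \<longrightarrow> norm (A (L1_mult (osc t) f)) \<le> 1 / 4"
  proof (rule ccontr)
    assume "\<not> ?thesis"
    then have "\<forall>n. \<exists>t. real (Suc n) \<le> \<bar>t\<bar> \<and> norm (A (L1_mult (osc t) f)) > 1 / 4"
      by (metis not_less of_nat_0_less_iff zero_less_Suc)
    then obtain t where t: "\<And>n. real (Suc n) \<le> \<bar>t n\<bar>" "\<And>n. norm (A (L1_mult (osc (t n)) f)) > 1 / 4"
      by metis
    have "filterlim (\<lambda>n. \<i> * of_real (t n)) at_infinity sequentially"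
    proof (rule filterlim_norm_at_top_imp_at_infinity)
      show "filterlim (\<lambda>n. norm (\<i> * of_real (t n))) at_top sequentially"
        by (rule filterlim_at_top_mono[OF filterlim_real_sequentially])
          (rule always_eventually, use t(1) in \<open>simp add: norm_mult, smt (verit)\<close>)
    qed
    then have "(\<lambda>n. norm (A (L1_mult (osc (t n)) f))) \<longlonglongrightarrow> 0"
      unfolding osc_def[abs_def] by (intro oscillation_decay) auto
    then have "\<forall>\<^sub>F n in sequentially. norm (A (L1_mult (osc (t n)) f)) < 1 / 4"
      by (rule order_tendstoD) simp
    then show False using t(2) by (auto simp: eventually_sequentially not_less[symmetric] dest: less_asym)
  qed
  then show ?thesis using that by blast
qed

text \<open>
  Beyond the threshold for \<open>g\<close>, contractivity of \<open>A\<close> leaves \<open>\<parallel>A (e\<^sub>t h)\<parallel> \<le> 1/4 + 1/8\<close> and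
  \<open>\<parallel>h\<parallel> \<ge> 7/8\<close> for all \<open>h\<close> near \<open>g\<close>. Below the threshold the doubling inequality takes over, since
  it holds for every nonnegative \<open>h\<close> with the same constant.
\<close>

lemma gap_near:
  assumes g: "norm g = 1" and T: "0 < T" "\<And>t. T \<le> \<bar>t\<bar> \<Longrightarrow> norm (A (L1_mult (osc t) g)) \<le> 1 / 4"
    and h: "L1_nonneg h" "norm (h - g) \<le> 1 / 8"
  shows "1 / 2 * min 1 ((t / (2 * T))\<^sup>2) \<le> norm h - norm (A (L1_mult (osc t) h))"
proof (rule doubling_lower_bound[OF _ _ _ T(1)])
  note lin = bounded_linear_L1_mult[OF osc_measurable, where C=1, simplified]
  have contr: "norm (L1_mult (osc t) f) \<le> norm f" for t and f :: "pos L1"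
    using rep_L1_mult(3)[OF osc_measurable, where C=1] by simp
  fix t
  show "norm h - norm (A (L1_mult (osc (2 * t)) h)) \<le> 4 * (norm h - norm (A (L1_mult (osc t) h)))"
    using doubling[OF h(1) osc_measurable, of t] by (simp add: osc_double[abs_def])
  show "0 \<le> norm h - norm (A (L1_mult (osc t) h))"
    using norm_le[of "L1_mult (osc t) h"] contr[of t h] by simp
  assume t: "T \<le> \<bar>t\<bar>"
  have "A (L1_mult (osc t) h) = A (L1_mult (osc t) g) + A (L1_mult (osc t) (h - g))"
    using bounded_linear.linear[OF bounded_linear_compose[OF linear lin[of t]], THEN linear_diff, of h g] by simp
  then have "norm (A (L1_mult (osc t) h)) \<le> 1 / 4 + norm (A (L1_mult (osc t) (h - g)))"
    using T(2)[OF t] norm_triangle_ineq[of "A (L1_mult (osc t) g)" "A (L1_mult (osc t) (h - g))"] by simp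
  also have "norm (A (L1_mult (osc t) (h - g))) \<le> 1 / 8"
    using norm_le contr h(2) by (meson order_trans)
  finally have "norm (A (L1_mult (osc t) h)) \<le> 3 / 8" by simp
  moreover have "7 / 8 \<le> norm h" using norm_triangle_ineq2[of g h] g h(2) by (simp add: norm_minus_commute)
  ultimately show "1 / 2 \<le> norm h - norm (A (L1_mult (osc t) h))" by simp
qed simp

text \<open>
  Compactness yields finitely many centres whose thresholds have a common maximum. The radius
  \<open>1/16\<close> is allotted twice: for the distance from a centre to \<open>g\<close> and for that from \<open>g\<close> to \<open>h\<close>.
\<close>

lemma uniform_gap:
  assumes comp: "compact (closure S)" and S: "\<And>g. g \<in> S \<Longrightarrow> norm g = 1"
  obtains T where "0 < T" "\<And>g h t. g \<in> S \<Longrightarrow> L1_nonneg h \<Longrightarrow> norm (h - g) \<le> 1 / 16 \<Longrightarrow>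
    1 / 2 * min 1 ((t / (2 * T))\<^sup>2) \<le> norm h - norm (A (L1_mult (osc t) h))"
proof -
  have "closure S \<subseteq> (\<Union>g\<in>S. ball g (1 / 16))"
  proof
    fix x assume "x \<in> closure S"
    then obtain g where "g \<in> S" "dist g x < 1 / 16"
      using closure_approachable[of x S] by (metis zero_less_divide_1_iff zero_less_numeral)
    then show "x \<in> (\<Union>g\<in>S. ball g (1 / 16))" by auto
  qed
  then obtain D where D: "D \<subseteq> S" "finite D" "closure S \<subseteq> (\<Union>g\<in>D. ball g (1 / 16))"
    using compactE_image[OF comp, of S "\<lambda>g. ball g (1 / 16)"] by (metis open_ball)
  have "\<exists>T. 0 < T \<and> (\<forall>t. T \<le> \<bar>t\<bar> \<longrightarrow> norm (A (L1_mult (osc t) g)) \<le> 1 / 4)" for g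
    using frequency_threshold[of g] by metis
  then obtain T where T: "\<And>g. 0 < T g" "\<And>g t. T g \<le> \<bar>t\<bar> \<Longrightarrow> norm (A (L1_mult (osc t) g)) \<le> 1 / 4"
    by metis
  define T' where "T' = Max (insert 1 (T ` D))"
  have T': "1 \<le> T'" "\<And>g. g \<in> D \<Longrightarrow> T g \<le> T'"
    unfolding T'_def using D(2) by auto
  show ?thesis
  proof (rule that)
    show "0 < T'" using T' by simp
    fix g h t assume g: "g \<in> S" and h: "L1_nonneg h" "norm (h - g) \<le> 1 / 16"
    obtain d where d: "d \<in> D" "dist d g < 1 / 16"
      using D(3) closure_subset[of S] g by auto
    have "norm (h - d) \<le> norm (h - g) + norm (g - d)"
      using norm_triangle_ineq[of "h - g" "g - d"] by simp
    then have "norm (h - d) \<le> 1 / 8"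
      using d(2) h(2) by (simp add: dist_norm norm_minus_commute)
    moreover have "norm d = 1" using D(1) d(1) S by auto
    ultimately show "1 / 2 * min 1 ((t / (2 * T'))\<^sup>2) \<le> norm h - norm (A (L1_mult (osc t) h))"
      using T' d(1) by (intro gap_near[OF _ _ _ h(1)] T(2)) force+
  qed
qed

end

lemma damping_measurable: "damping a z \<in> borel_measurable vpos"
proof -
  have "(\<lambda>v. damping a z v) \<in> borel_measurable borel"
    unfolding damping_def by measurable
  then show ?thesis by (rule measurable_vpos)
qed

lemma damping_eq: "v > 0 \<Longrightarrow> damping a z v = osc (2 * a * Im z) v * of_real (exp (- 2 * a * Re z / v))"
proof -
  assume v: "v > 0"
  have "- 2 * z * of_real a / of_real \<bar>v\<bar> = - (\<i> * of_real (2 * a * Im z)) / of_real v + of_real (- 2 * a * Re z / v)"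
    using v by (simp add: complex_eq_iff Re_divide_of_real Im_divide_of_real)
  then show ?thesis
    unfolding damping_def osc_def by (simp only: exp_add exp_of_real)
qed

lemma norm_damping_le_1: "a > 0 \<Longrightarrow> Re z \<ge> 0 \<Longrightarrow> norm (damping a z v) \<le> 1"
  by (simp add: damping_def Re_divide_of_real divide_nonneg_nonneg)

lemma norm_L1_mult_damping_le:
  "a > 0 \<Longrightarrow> Re z \<ge> 0 \<Longrightarrow> norm (L1_mult (damping a z) f :: pos L1) \<le> norm f"
  using rep_L1_mult(3)[OF damping_measurable, of a z 1 f] norm_damping_le_1 by simp

lemma min_1_mult: "0 \<le> p \<Longrightarrow> 0 \<le> q \<Longrightarrow> min 1 p * min 1 q \<le> min 1 (p * q :: real)"
  using mult_mono[of "min 1 p" p "min 1 q" q] mult_mono[of "min 1 p" 1 "min 1 q" 1] by simp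

context stochastic_kernel
begin

text \<open>
  Write \<open>z = \<sigma> + i\<tau>\<close>. The real part of the exponent turns \<open>g\<close> into \<open>h = e\<^sup>-\<^sup>2\<^sup>a\<^sup>\<sigma>\<^sup>/\<^sup>v g\<close> with
  \<open>\<parallel>h - g\<parallel> = 1 - \<parallel>h\<parallel>\<close>. Either this loss of mass exceeds \<open>1/16\<close>, or \<open>h\<close> is so close to
  \<open>g\<close> that the oscillating factor produces the gap of order \<open>min(1, \<tau>\<^sup>2)\<close>. Independently of that,
  \<open>\<parallel>h\<parallel> \<le> e\<^sup>-\<^sup>2\<^sup>a\<^sup>\<sigma>\<close> is a gap of order at least \<open>min(1, \<sigma>\<^sup>2)\<close>, and the two add up to one of order
  \<open>min(1, |z|\<^sup>2)\<close>.
\<close>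

lemma damped_gap:
  assumes a: "a > 0" and comp: "compact (closure S)"
    and S: "\<And>g. g \<in> S \<Longrightarrow> norm g = 1" "\<And>g. g \<in> S \<Longrightarrow> L1_nonneg g"
  obtains c where "0 < c" "c \<le> 1" "\<And>z g. Re z \<ge> 0 \<Longrightarrow> g \<in> S \<Longrightarrow>
      norm (A (L1_mult (damping a z) g)) \<le> 1 - c * min 1 ((norm z)\<^sup>2)"
proof -
  obtain T where T: "0 < T" and gap: "\<And>g h t. g \<in> S \<Longrightarrow> L1_nonneg h \<Longrightarrow> norm (h - g) \<le> 1 / 16 \<Longrightarrow>
      1 / 2 * min 1 ((t / (2 * T))\<^sup>2) \<le> norm h - norm (A (L1_mult (osc t) h))"
    using uniform_gap[OF comp S(1)] by blast
  define c1 where "c1 = min (1 / 16) (1 / 2 * min 1 ((a / T)\<^sup>2))"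
  define c2 where "c2 = 2 * a / (1 + 2 * a)"
  have c1: "0 < c1" "c1 \<le> 1 / 16" using a T by (auto simp: c1_def)
  have c2: "0 < c2" "c2 \<le> 1" using a by (auto simp: c2_def)
  define c where "c = min c1 c2 / 2"
  show ?thesis
  proof (rule that)
    show "0 < c" "c \<le> 1" using c1 c2 by (auto simp: c_def)
    fix z :: complex and g assume z: "Re z \<ge> 0" and g: "g \<in> S"
    let ?e = "\<lambda>v::real. complex_of_real (exp (- 2 * a * Re z / v))"
    let ?N = "norm (A (L1_mult (damping a z) g))"
    have em: "?e \<in> borel_measurable vpos" by (rule measurable_vpos) measurable
    have e1: "exp (- 2 * a * Re z / v) \<le> exp (- 2 * a * Re z)" if "v \<in> {0<..<1}" for v
    proof -
      have "2 * a * Re z * v \<le> 2 * a * Re z * 1" using that a z by (intro mult_left_mono) auto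
      then show ?thesis using that by (simp add: field_simps)
    qed
    have e2: "exp (- 2 * a * Re z) \<le> 1" using a z by simp
    define h where "h = L1_mult ?e g"
    have reph: "AE v in vpos. rep_L1 h v = ?e v * rep_L1 g v"
      unfolding h_def by (rule rep_L1_mult(2)[OF em, of "exp (- 2 * a * Re z)"])
        (use e1 in \<open>auto simp: velocities_pos_def simp del: of_real_exp\<close>)
    have nh: "norm h \<le> exp (- 2 * a * Re z)"
      using rep_L1_mult(3)[OF em, of "exp (- 2 * a * Re z)" g] e1 S(1)[OF g]
      by (simp add: velocities_pos_def h_def del: of_real_exp)
    have h: "L1_nonneg h"
      unfolding L1_nonneg_def using reph S(2)[OF g, unfolded L1_nonneg_def]
      by eventually_elim (simp add: complex_nonneg_Reals_iff del: of_real_exp)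
    have repd: "AE v in vpos. rep_L1 (L1_mult (damping a z) g) v = damping a z v * rep_L1 g v"
      by (rule rep_L1_mult(2)[OF damping_measurable, where C=1]) (use norm_damping_le_1[OF a z] in auto)
    have "AE v in vpos. rep_L1 (L1_mult (osc (2 * a * Im z)) h) v = osc (2 * a * Im z) v * rep_L1 h v"
      by (rule rep_L1_mult(2)[OF osc_measurable, where C=1]) auto
    then have "AE v in vpos. rep_L1 (L1_mult (damping a z) g) v = rep_L1 (L1_mult (osc (2 * a * Im z)) h) v"
      using repd reph AE_space
    proof eventually_elim
      case (elim v)
      then show ?case using damping_eq[of v a z] by simp
    qed
    then have eq: "L1_mult (damping a z) g = L1_mult (osc (2 * a * Im z)) h" by (rule L1_eqI)
    have "norm (L1_mult (osc (2 * a * Im z)) h) \<le> norm h"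
      using rep_L1_mult(3)[OF osc_measurable, where C=1 and f=h] by simp
    then have Nh: "?N \<le> norm h" unfolding eq using norm_le order_trans by blast
    have diff: "norm (h - g) = 1 - norm h"
    proof -
      have "norm (h - g) = (\<integral>v. norm (rep_L1 g v) - norm (rep_L1 h v) \<partial>vpos)"
        unfolding norm_L1_def
      proof (rule integral_cong_AE)
        show "AE v in vpos. norm (rep_L1 (h - g) v) = norm (rep_L1 g v) - norm (rep_L1 h v)"
          using rep_L1_diff[of h g] reph AE_space
        proof eventually_elim
          case (elim v)
          let ?x = "exp (- 2 * a * Re z / v)"
          have "?x \<le> 1" using e1[of v] e2 elim(3) by simp
          then have abs: "\<bar>?x - 1\<bar> = 1 - ?x" by simp
          have "rep_L1 (h - g) v = of_real (?x - 1) * rep_L1 g v"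
            unfolding elim(1,2) by (simp add: algebra_simps)
          then have "norm (rep_L1 (h - g) v) = (1 - ?x) * norm (rep_L1 g v)"
            by (simp only: norm_mult norm_of_real abs)
          moreover have "norm (rep_L1 h v) = ?x * norm (rep_L1 g v)"
            unfolding elim(2) by (simp only: norm_mult norm_of_real abs_exp_cancel)
          ultimately show ?case by (simp add: algebra_simps)
        qed
      qed measurable
      also have "\<dots> = norm g - norm h" by (simp add: norm_L1_def)
      finally show ?thesis using S(1)[OF g] by simp
    qed
    have imag: "c1 * min 1 ((Im z)\<^sup>2) \<le> 1 - ?N"
    proof (cases "norm (h - g) \<le> 1 / 16")
      case True
      have "c1 * min 1 ((Im z)\<^sup>2) \<le> 1 / 2 * min 1 ((a / T)\<^sup>2) * min 1 ((Im z)\<^sup>2)"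
        by (intro mult_right_mono) (auto simp: c1_def)
      also have "\<dots> \<le> 1 / 2 * min 1 ((a / T)\<^sup>2 * (Im z)\<^sup>2)"
        using min_1_mult[of "(a / T)\<^sup>2" "(Im z)\<^sup>2"] by simp
      also have "(a / T)\<^sup>2 * (Im z)\<^sup>2 = (2 * a * Im z / (2 * T))\<^sup>2"
        by (simp add: power_divide power_mult_distrib)
      also have "1 / 2 * min 1 \<dots> \<le> norm h - ?N"
        unfolding eq by (rule gap[OF g h True])
      also have "\<dots> \<le> 1 - ?N" using nh e2 by linarith
      finally show ?thesis .
    next
      case False
      have "c1 * min 1 ((Im z)\<^sup>2) \<le> 1 / 16 * 1" using c1 by (intro mult_mono) auto
      also have "\<dots> \<le> 1 - ?N" using False diff Nh by simp
      finally show ?thesis .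
    qed
    have real: "c2 * min 1 ((Re z)\<^sup>2) \<le> 1 - ?N"
    proof -
      let ?s = "Re z"
      have "1 + 2 * a * ?s \<le> exp (2 * a * ?s)" by (rule exp_ge_add_one_self)
      then have "exp (- 2 * a * ?s) \<le> 1 / (1 + 2 * a * ?s)"
        using a z by (simp add: exp_minus field_simps add_pos_nonneg)
      moreover have "c2 * min 1 (?s\<^sup>2) \<le> 1 - 1 / (1 + 2 * a * ?s)"
      proof (cases "?s \<le> 1")
        case True
        have "c2 * min 1 (?s\<^sup>2) \<le> c2 * ?s"
          using c2 True z by (intro mult_left_mono) (auto simp: min_le_iff_disj power2_eq_square mult_left_le)
        also have "\<dots> = 2 * a * ?s / (1 + 2 * a)" by (simp add: c2_def)
        also have "\<dots> \<le> 2 * a * ?s / (1 + 2 * a * ?s)"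
          using a z True by (intro divide_left_mono) (auto intro!: mult_pos_pos add_pos_nonneg mult_left_le)
        also have "\<dots> = 1 - 1 / (1 + 2 * a * ?s)"
          using a z add_pos_nonneg[of 1 "2 * a * ?s"] by (simp add: field_simps)
        finally show ?thesis .
      next
        case False
        have "c2 * min 1 (?s\<^sup>2) \<le> c2 * 1" using c2 by (intro mult_left_mono) auto
        also have "\<dots> = 1 - 1 / (1 + 2 * a)" using a by (simp add: c2_def field_simps)
        also have "\<dots> \<le> 1 - 1 / (1 + 2 * a * ?s)"
          using a z False by (intro diff_left_mono divide_left_mono) (auto intro!: mult_pos_pos add_pos_nonneg)
        finally show ?thesis .
      qed
      ultimately show ?thesis using Nh nh by linarith
    qed
    have "min 1 ((norm z)\<^sup>2) \<le> min 1 ((Re z)\<^sup>2) + min 1 ((Im z)\<^sup>2)"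
      using zero_le_power2[of "Re z"] zero_le_power2[of "Im z"] unfolding cmod_power2 by linarith
    then have "c * min 1 ((norm z)\<^sup>2) \<le> c * (min 1 ((Re z)\<^sup>2) + min 1 ((Im z)\<^sup>2))"
      using \<open>0 < c\<close> by (intro mult_left_mono) auto
    also have "\<dots> \<le> (c2 * min 1 ((Re z)\<^sup>2) + c1 * min 1 ((Im z)\<^sup>2)) / 2"
    proof -
      have "min c1 c2 * min 1 ((Re z)\<^sup>2) \<le> c2 * min 1 ((Re z)\<^sup>2)" "min c1 c2 * min 1 ((Im z)\<^sup>2) \<le> c1 * min 1 ((Im z)\<^sup>2)"
        by (intro mult_right_mono, auto)+
      then show ?thesis by (simp add: c_def field_simps)
    qed
    also have "\<dots> \<le> 1 - ?N" using imag real by simp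
    finally show "?N \<le> 1 - c * min 1 ((norm z)\<^sup>2)" by simp
  qed
qed

end

section \<open>From the positive cone to the whole space\<close>

text \<open>
  Peculiar to \<open>L\<^sup>1\<close>: norms of functions with disjoint supports add up. A simple function
  \<open>\<Sum> c\<^sub>i 1\<^sub>X\<^sub>i\<close> with disjoint \<open>X\<^sub>i\<close> is therefore mapped to something of norm at most
  \<open>\<Sum> |c\<^sub>i| C \<mu>(X\<^sub>i)\<close>, which is \<open>C\<close> times its own norm. The usual passage
  through \<open>|T f| \<le> T |f|\<close> is not available in the application, where \<open>T\<close> has an oscillating
  complex kernel.
\<close>

lemma bound_from_positive_cone:
  fixes T :: "pos L1 \<Rightarrow> 'e::velocity_domain L1"
  assumes T: "bounded_linear T" and hom: "\<And>c f. norm (T (L1_mult (\<lambda>_. c) f)) \<le> norm c * norm (T f)"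
    and pos: "\<And>f. L1_nonneg f \<Longrightarrow> norm (T f) \<le> C * norm f"
  shows "norm (T f) \<le> C * norm f"
proof -
  interpret T: bounded_linear T by fact
  have fin: "emeasure vpos X \<noteq> \<infinity>" for X
    using finite_measure.emeasure_finite[OF finite_measure_vpos] by simp
  have int: "integrable vpos s" if "simple_function vpos s" for s :: "real \<Rightarrow> complex"
    using that fin by (intro integrable_simple_function) auto
  have simple: "norm (T (abs_L1 s)) \<le> C * (\<integral>v. norm (s v) \<partial>vpos)" if "simple_function vpos s" for s :: "real \<Rightarrow> complex"
    using that fin
  proof (induction rule: integrable_simple_function_induct)
    case (cong f g)
    have "abs_L1 f = (abs_L1 g :: pos L1)"
      using cong int by (subst abs_L1_eq_iff) auto
    moreover have "(\<integral>v. norm (f v) \<partial>vpos) = (\<integral>v. norm (g v) \<partial>vpos)"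
      using cong by (intro Bochner_Integration.integral_cong) auto
    ultimately show ?case using cong by simp
  next
    case (indicator X y)
    let ?i = "\<lambda>v. indicator X v *\<^sub>R (1::complex)"
    have ii: "integrable vpos ?i" using indicator by simp
    define p :: "pos L1" where "p = abs_L1 ?i"
    have rp: "AE v in vpos. rep_L1 p v = ?i v"
      unfolding p_def by (rule AE_rep_abs_L1[OF ii])
    have np: "L1_nonneg p"
      unfolding L1_nonneg_def using rp by eventually_elim (simp add: indicator_def)
    have "abs_L1 (\<lambda>v. indicator X v *\<^sub>R y) = L1_mult (\<lambda>_. y) p"
      unfolding L1_mult_def
    proof (subst abs_L1_eq_iff)
      show "integrable vpos (\<lambda>v. indicator X v *\<^sub>R y)" using indicator by simp
      show "integrable vpos (\<lambda>v. y * rep_L1 p v)" by simp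
      show "AE v in vpos. indicator X v *\<^sub>R y = y * rep_L1 p v"
        using rp by eventually_elim simp
    qed
    then have "norm (T (abs_L1 (\<lambda>v. indicator X v *\<^sub>R y))) \<le> norm y * norm (T p)"
      using hom by simp
    also have "\<dots> \<le> norm y * (C * norm p)"
      using pos[OF np] by (intro mult_left_mono) auto
    also have "norm p = (\<integral>v. indicator X v \<partial>vpos)"
      unfolding p_def norm_abs_L1[OF ii] by (rule Bochner_Integration.integral_cong) auto
    also have "norm y * (C * (\<integral>v. indicator X v \<partial>vpos)) = C * (\<integral>v. norm (indicator X v *\<^sub>R y) \<partial>vpos)"
      by simp
    finally show ?case .
  next
    case (add f g)
    have i: "integrable vpos f" "integrable vpos g" using add int by auto
    have "abs_L1 (\<lambda>v. f v + g v) = (abs_L1 f + abs_L1 g :: pos L1)"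
      unfolding plus_L1_def
      by (subst abs_L1_eq_iff)
        (use i AE_rep_abs_L1[OF i(1)] AE_rep_abs_L1[OF i(2)] in auto)
    then have "norm (T (abs_L1 (\<lambda>v. f v + g v))) \<le> norm (T (abs_L1 f)) + norm (T (abs_L1 g))"
      by (simp add: T.add norm_triangle_ineq)
    also have "\<dots> \<le> C * (\<integral>v. norm (f v) + norm (g v) \<partial>vpos)"
      using add i by (simp add: distrib_left)
    also have "(\<integral>v. norm (f v) + norm (g v) \<partial>vpos) = (\<integral>v. norm (f v + g v) \<partial>vpos)"
      using add by (intro Bochner_Integration.integral_cong) auto
    finally show ?case .
  qed
  obtain s where s: "\<And>i. simple_function vpos (s i)" "\<And>v. v \<in> space vpos \<Longrightarrow> (\<lambda>i. s i v) \<longlonglongrightarrow> rep_L1 f v"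
    "\<And>i v. v \<in> space vpos \<Longrightarrow> norm (s i v) \<le> 2 * norm (rep_L1 f v)"
    using borel_measurable_implies_sequence_metric[OF measurable_rep_L1[of f], of 0]
    unfolding dist_0_norm dist_norm diff_zero by metis
  have "(\<lambda>i. \<integral>v. norm (s i v - rep_L1 f v) \<partial>vpos) \<longlonglongrightarrow> (\<integral>v. 0 \<partial>vpos)"
  proof (rule integral_dominated_convergence)
    show "integrable vpos (\<lambda>v. 3 * norm (rep_L1 f v))" by simp
    show "AE v in vpos. (\<lambda>i. norm (s i v - rep_L1 f v)) \<longlonglongrightarrow> 0"
      by (rule AE_I2) (intro tendsto_norm_zero LIM_zero s(2))
    show "AE v in vpos. norm (norm (s i v - rep_L1 f v)) \<le> 3 * norm (rep_L1 f v)" for i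
    proof (rule AE_I2)
      fix v assume "v \<in> space vpos"
      from s(3)[OF this, of i] norm_triangle_ineq4[of "s i v" "rep_L1 f v"]
      show "norm (norm (s i v - rep_L1 f v)) \<le> 3 * norm (rep_L1 f v)" by simp
    qed
  qed (use int[OF s(1)] in \<open>auto\<close>)
  then have "(\<lambda>i. norm (abs_L1 (s i) - f)) \<longlonglongrightarrow> 0"
    using dist_abs_L1[OF int[OF s(1)] integrable_rep_L1[of f]] by simp
  then have lim: "(\<lambda>i. abs_L1 (s i)) \<longlonglongrightarrow> f"
    by (rule LIM_zero_cancel[OF tendsto_norm_zero_cancel])
  have "norm (T (abs_L1 (s i))) \<le> C * norm (abs_L1 (s i) :: pos L1)" for i
    using simple[OF s(1)] norm_abs_L1[OF int[OF s(1)]] by simp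
  then show ?thesis
    by (intro LIMSEQ_le[OF tendsto_norm[OF T.tendsto[OF lim]] tendsto_mult[OF tendsto_const tendsto_norm[OF lim]]]) auto
qed

section \<open>Reflection of velocities\<close>

lemma space_vmeasure: "space (vmeasure TYPE('f::velocity_domain)) = velocities TYPE('f)"
  by (simp add: vmeasure_def space_restrict_space)

locale opposite_velocities =
  fixes d :: "'d::velocity_domain itself" and e :: "'e::velocity_domain itself"
  assumes opposite: "v \<in> velocities TYPE('e) \<longleftrightarrow> - v \<in> velocities TYPE('d)"
begin

lemma uminus_measurable: "uminus \<in> measurable (vmeasure TYPE('d)) (vmeasure TYPE('e))"
  unfolding vmeasure_def
  by (rule measurable_restrict_space3) (auto simp: opposite)

lemma distr_uminus: "distr (vmeasure TYPE('d)) (vmeasure TYPE('e)) uminus = vmeasure TYPE('e)"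
proof (rule measure_eqI)
  fix X assume "X \<in> sets (distr (vmeasure TYPE('d)) (vmeasure TYPE('e)) uminus)"
  then have X: "X \<in> sets (vmeasure TYPE('e))" by simp
  then have X': "X \<in> sets borel" "X \<subseteq> velocities TYPE('e)"
    using velocities_borel[where 'a='e] by (auto simp: vmeasure_def sets_restrict_space)
  have "uminus -` X \<inter> space (vmeasure TYPE('d)) = uminus -` X"
    using X'(2) by (auto simp: space_vmeasure opposite)
  moreover have "uminus -` X \<subseteq> velocities TYPE('d)"
    using X'(2) by (auto simp: opposite)
  moreover have "emeasure lborel (uminus -` X) = emeasure lborel X"
    using emeasure_distr[of "uminus :: real \<Rightarrow> real" lborel borel X] X'(1) by (simp add: lborel_distr_uminus)
  ultimately show "emeasure (distr (vmeasure TYPE('d)) (vmeasure TYPE('e)) uminus) X = emeasure (vmeasure TYPE('e)) X"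
    using X X'(2) velocities_borel[where 'a='e] velocities_borel[where 'a='d]
    by (simp add: emeasure_distr[OF uminus_measurable X]) (simp add: vmeasure_def emeasure_restrict_space)
qed simp

lemma measurable_uminus:
  "F \<in> borel_measurable (vmeasure TYPE('e)) \<Longrightarrow> (\<lambda>v. F (- v)) \<in> borel_measurable (vmeasure TYPE('d))"
  by (rule measurable_compose[OF uminus_measurable])

lemma integrable_uminus:
  fixes F :: "real \<Rightarrow> 'b::{banach, second_countable_topology}"
  assumes "integrable (vmeasure TYPE('e)) F"
  shows "integrable (vmeasure TYPE('d)) (\<lambda>v. F (- v))"
  using integrable_distr[OF uminus_measurable, of F] assms by (simp add: distr_uminus)

lemma integral_uminus:
  fixes F :: "real \<Rightarrow> 'b::{banach, second_countable_topology}"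
  assumes "F \<in> borel_measurable (vmeasure TYPE('e))"
  shows "(\<integral>v. F (- v) \<partial>vmeasure TYPE('d)) = (\<integral>v. F v \<partial>vmeasure TYPE('e))"
  using integral_distr[OF uminus_measurable assms] by (simp add: distr_uminus)

lemma AE_uminus:
  assumes "AE v in vmeasure TYPE('e). P v" shows "AE v in vmeasure TYPE('d). P (- v)"
  using AE_distrD[OF uminus_measurable, of P] assms unfolding distr_uminus by blast

end

interpretation pos_neg: opposite_velocities "TYPE(pos)" "TYPE(neg)"
  by standard (auto simp: velocities_pos_def velocities_neg_def)

interpretation neg_pos: opposite_velocities "TYPE(neg)" "TYPE(pos)"
  by standard (auto simp: velocities_pos_def velocities_neg_def)

text \<open>
  Pullback along \<open>v \<mapsto> - v\<close> is needed in both directions: one turns representatives on \<open>'d\<close> into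
  representatives on \<open>'e\<close>, the other describes the reflected function by its values on \<open>'d\<close>.
\<close>

locale velocity_reflection =
  fwd: opposite_velocities d e + bwd: opposite_velocities e d
  for d :: "'d::velocity_domain itself" and e :: "'e::velocity_domain itself"
begin

lemma rep_reflect: "AE v in vmeasure TYPE('e). rep_L1 (reflect (f :: 'd L1) :: 'e L1) v = rep_L1 f (- v)"
  unfolding reflect_def by (rule AE_rep_abs_L1) (rule bwd.integrable_uminus, simp)

lemma rep_reflect': "AE v in vmeasure TYPE('d). rep_L1 (reflect (f :: 'd L1) :: 'e L1) (- v) = rep_L1 f v"
  using fwd.AE_uminus[OF rep_reflect[of f]] by simp

lemma norm_reflect: "norm (reflect (f :: 'd L1) :: 'e L1) = norm f"
proof -
  have "norm (reflect f :: 'e L1) = (\<integral>v. norm (rep_L1 f (- v)) \<partial>vmeasure TYPE('e))"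
    unfolding reflect_def by (rule norm_abs_L1) (rule bwd.integrable_uminus, simp)
  also have "\<dots> = norm f"
    unfolding norm_L1_def by (rule bwd.integral_uminus[of "\<lambda>v. norm (rep_L1 f v)"]) simp
  finally show ?thesis .
qed

lemma bounded_linear_reflect: "bounded_linear (reflect :: 'd L1 \<Rightarrow> 'e L1)"
proof (rule bounded_linear_intro[of _ 1])
  fix f g :: "'d L1" and r :: real
  show "reflect (f + g) = (reflect f + reflect g :: 'e L1)"
    by (rule L1_eqI)
      (use rep_reflect[of "f + g"] rep_reflect[of f] rep_reflect[of g] bwd.AE_uminus[OF rep_L1_add[of f g]]
        rep_L1_add[of "reflect f :: 'e L1" "reflect g"] in \<open>eventually_elim, simp\<close>)
  show "reflect (r *\<^sub>R f) = (r *\<^sub>R reflect f :: 'e L1)"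
    by (rule L1_eqI)
      (use rep_reflect[of "r *\<^sub>R f"] rep_reflect[of f] bwd.AE_uminus[OF rep_L1_scaleR[of r f]]
        rep_L1_scaleR[of r "reflect f :: 'e L1"] in \<open>eventually_elim, simp\<close>)
qed (simp add: norm_reflect)

lemma L1_nonneg_reflect: "L1_nonneg (f :: 'd L1) \<Longrightarrow> L1_nonneg (reflect f :: 'e L1)"
  unfolding L1_nonneg_def
  using rep_reflect[of f] bwd.AE_uminus[of "\<lambda>v. rep_L1 f v \<in> \<real>\<^sub>\<ge>\<^sub>0"]
  by (auto elim!: eventually_elim2)

lemma reflect_reflect: "reflect (reflect (f :: 'd L1) :: 'e L1) = f"
proof (rule L1_eqI)
  have "AE v in vmeasure TYPE('d). rep_L1 (reflect (reflect f :: 'e L1) :: 'd L1) v = rep_L1 (reflect f :: 'e L1) (- v)"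
    unfolding reflect_def[of "reflect f :: 'e L1"]
    by (rule AE_rep_abs_L1) (rule fwd.integrable_uminus, simp)
  then show "AE v in vmeasure TYPE('d). rep_L1 (reflect (reflect f :: 'e L1) :: 'd L1) v = rep_L1 f v"
    using rep_reflect'[of f] by eventually_elim simp
qed

lemma reflect_mult:
  assumes h: "h \<in> borel_measurable (vmeasure TYPE('d))" "h \<in> borel_measurable (vmeasure TYPE('e))"
    and b: "\<And>v. norm (h v) \<le> C" and even: "\<And>v. h (- v) = h v"
  shows "reflect (L1_mult h f :: 'd L1) = (L1_mult h (reflect f) :: 'e L1)"
proof (rule L1_eqI)
  have 1: "AE v in vmeasure TYPE('d). rep_L1 (L1_mult h f) v = h v * rep_L1 f v"
    by (rule rep_L1_mult(2)[OF h(1)]) (rule b)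
  have 2: "AE v in vmeasure TYPE('e). rep_L1 (L1_mult h (reflect f) :: 'e L1) v = h v * rep_L1 (reflect f :: 'e L1) v"
    by (rule rep_L1_mult(2)[OF h(2)]) (rule b)
  show "AE v in vmeasure TYPE('e). rep_L1 (reflect (L1_mult h f) :: 'e L1) v = rep_L1 (L1_mult h (reflect f) :: 'e L1) v"
    using bwd.AE_uminus[OF 1] 2 rep_reflect[of "L1_mult h f"] rep_reflect[of f]
    by eventually_elim (simp add: even)
qed

end

interpretation reflect_pos: velocity_reflection "TYPE(pos)" "TYPE(neg)" ..
interpretation reflect_neg: velocity_reflection "TYPE(neg)" "TYPE(pos)" ..

lemma stochastic_kernel_comp_reflect:
  fixes K :: "neg L1 \<Rightarrow> pos L1"
  assumes "stochastic K" "integral_operator k K"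
  shows "stochastic_kernel (\<lambda>f :: pos L1. K (reflect f)) (\<lambda>v w. k v (- w))"
proof
  show "stochastic (\<lambda>f :: pos L1. K (reflect f))"
    using assms(1) unfolding stochastic_def
    by (auto intro: bounded_linear_compose[OF _ reflect_pos.bounded_linear_reflect]
        simp: reflect_pos.L1_nonneg_reflect reflect_pos.norm_reflect)
  have meas: "k v \<in> borel_measurable (vmeasure TYPE(neg))" if "v \<in> {0<..<1}" for v
  proof -
    have "(\<lambda>w. (\<lambda>(v, w). k v w) (v, w)) \<in> borel_measurable (vmeasure TYPE(neg))"
      using assms(2) that by (intro measurable_Pair2[of _ vpos]) (auto simp: integral_operator_def)
    then show ?thesis by simp
  qed
  show "represents (\<lambda>v w. k v (- w)) (\<lambda>f :: pos L1. K (reflect f))"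
    unfolding represents_def
  proof (intro conjI ballI allI)
    fix v :: real assume "v \<in> {0<..<1}"
    then show "(\<lambda>w. k v (- w)) \<in> borel_measurable vpos"
      by (intro pos_neg.measurable_uminus meas)
  next
    fix f :: "pos L1"
    let ?g = "reflect f :: neg L1"
    have "AE v in vpos. integrable (vmeasure TYPE(neg)) (\<lambda>w. of_real (k v w) * rep_L1 ?g w) \<and>
        rep_L1 (K ?g) v = (\<integral>w. of_real (k v w) * rep_L1 ?g w \<partial>vmeasure TYPE(neg))"
      using assms(2) by (simp add: integral_operator_def)
    then show "AE v in vpos. integrable vpos (\<lambda>w. of_real (k v (- w)) * rep_L1 f w) \<and>
        rep_L1 (K ?g) v = (\<integral>w. of_real (k v (- w)) * rep_L1 f w \<partial>vpos)"
      using AE_space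
    proof eventually_elim
      case (elim v)
      let ?F = "\<lambda>w. of_real (k v w) * rep_L1 ?g w"
      have i: "integrable vpos (\<lambda>w. ?F (- w))"
        using elim by (intro pos_neg.integrable_uminus) simp
      have m: "(\<lambda>w. of_real (k v (- w)) * rep_L1 f w) \<in> borel_measurable vpos"
        using meas[of v] elim
        by (intro borel_measurable_times borel_measurable_of_real pos_neg.measurable_uminus) auto
      have ae: "AE w in vpos. ?F (- w) = of_real (k v (- w)) * rep_L1 f w"
        using reflect_pos.rep_reflect'[of f] by eventually_elim simp
      have "(\<integral>w. ?F w \<partial>vmeasure TYPE(neg)) = (\<integral>w. ?F (- w) \<partial>vpos)"
        using elim by (intro pos_neg.integral_uminus[symmetric] borel_measurable_integrable) simp
      also have "\<dots> = (\<integral>w. of_real (k v (- w)) * rep_L1 f w \<partial>vpos)"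
        by (rule integral_cong_AE[OF borel_measurable_integrable[OF i] m ae])
      finally show ?case
        using elim integrable_cong_AE_imp[OF i m] ae by (auto elim: eventually_mono)
    qed
  qed
qed

lemma stochastic_kernel_reflect_comp:
  fixes K :: "pos L1 \<Rightarrow> neg L1"
  assumes "stochastic K" "integral_operator k K"
  shows "stochastic_kernel (\<lambda>f. reflect (K f) :: pos L1) (\<lambda>v w. k (- v) w)"
proof
  show "stochastic (\<lambda>f. reflect (K f) :: pos L1)"
    using assms(1) unfolding stochastic_def
    by (auto intro: bounded_linear_compose[OF reflect_neg.bounded_linear_reflect]
        simp: reflect_neg.L1_nonneg_reflect reflect_neg.norm_reflect)
  show "represents (\<lambda>v w. k (- v) w) (\<lambda>f. reflect (K f) :: pos L1)"
    unfolding represents_def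
  proof (intro conjI ballI allI)
    fix v :: real assume "v \<in> {0<..<1}"
    then have "(\<lambda>w. (\<lambda>(v, w). k v w) (- v, w)) \<in> borel_measurable vpos"
      using assms(2)
      by (intro measurable_Pair2[of _ "vmeasure TYPE(neg)"])
        (auto simp: integral_operator_def space_vmeasure velocities_neg_def)
    then show "(\<lambda>w. k (- v) w) \<in> borel_measurable vpos" by simp
  next
    fix f :: "pos L1"
    have "AE v in vmeasure TYPE(neg). integrable vpos (\<lambda>w. of_real (k v w) * rep_L1 f w) \<and>
        rep_L1 (K f) v = (\<integral>w. of_real (k v w) * rep_L1 f w \<partial>vpos)"
      using assms(2) by (simp add: integral_operator_def)
    from pos_neg.AE_uminus[OF this] reflect_neg.rep_reflect[of "K f"]
    show "AE v in vpos. integrable vpos (\<lambda>w. of_real (k (- v) w) * rep_L1 f w) \<and>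
        rep_L1 (reflect (K f) :: pos L1) v = (\<integral>w. of_real (k (- v) w) * rep_L1 f w \<partial>vpos)"
      by eventually_elim simp
  qed
qed

lemma compact_closure_subset:
  fixes C :: "'a::metric_space set"
  assumes "compact C" "X \<subseteq> C"
  shows "compact (closure X)"
proof -
  have "closure X \<subseteq> C" using assms by (intro closure_minimal compact_imp_closed)
  then have "closure X = C \<inter> closure X" by blast
  then show ?thesis using compact_Int_closed[OF assms(1) closed_closure] by metis
qed

lemma compact_operator_comp_reflect:
  fixes K :: "neg L1 \<Rightarrow> pos L1"
  assumes "compact_operator K"
  shows "compact_operator (\<lambda>f :: pos L1. K (reflect f))"
proof -
  have "(\<lambda>f :: pos L1. K (reflect f)) ` cball 0 1 \<subseteq> K ` cball 0 1"
    using reflect_pos.norm_reflect by auto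
  then have "(\<lambda>f :: pos L1. K (reflect f)) ` cball 0 1 \<subseteq> closure (K ` cball 0 1)"
    using closure_subset by blast
  moreover have "compact (closure (K ` cball 0 1))"
    using assms by (simp add: compact_operator_def)
  ultimately have "compact (closure ((\<lambda>f :: pos L1. K (reflect f)) ` cball 0 1))"
    by (rule compact_closure_subset[rotated])
  then show ?thesis
    using assms bounded_linear_compose[OF _ reflect_pos.bounded_linear_reflect]
    unfolding compact_operator_def by blast
qed

lemma compact_operator_reflect_comp:
  fixes K :: "pos L1 \<Rightarrow> neg L1"
  assumes "compact_operator K"
  shows "compact_operator (\<lambda>f. reflect (K f) :: pos L1)"
proof -
  have "(\<lambda>f. reflect (K f) :: pos L1) ` cball 0 1 \<subseteq> reflect ` closure (K ` cball 0 1)"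
    using closure_subset[of "K ` cball 0 1"] by auto
  moreover have "compact (reflect ` closure (K ` cball 0 1) :: pos L1 set)"
    using assms unfolding compact_operator_def
    by (intro compact_continuous_image linear_continuous_on reflect_neg.bounded_linear_reflect) auto
  ultimately have "compact (closure ((\<lambda>f. reflect (K f) :: pos L1) ` cball 0 1))"
    by (rule compact_closure_subset[rotated])
  then show ?thesis
    using assms bounded_linear_compose[OF reflect_neg.bounded_linear_reflect]
    unfolding compact_operator_def by blast
qed

section \<open>The gap for products with a compact factor\<close>

lemma L1_mult_commute:
  fixes f :: "pos L1"
  assumes h: "h \<in> borel_measurable vpos" "\<And>v. norm (h v) \<le> C"
  shows "L1_mult h (L1_mult (\<lambda>_. c) f) = L1_mult (\<lambda>_. c) (L1_mult h f)"
proof (rule L1_eqI)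
  have c: "AE v in vpos. rep_L1 (L1_mult (\<lambda>_. c) g) v = c * rep_L1 g v" for g :: "pos L1"
    by (rule rep_L1_mult(2)[where C="norm c"]) auto
  have h': "AE v in vpos. rep_L1 (L1_mult h g) v = h v * rep_L1 g v" for g :: "pos L1"
    by (rule rep_L1_mult(2)[OF h(1)]) (rule h(2))
  show "AE v in vpos. rep_L1 (L1_mult h (L1_mult (\<lambda>_. c) f)) v = rep_L1 (L1_mult (\<lambda>_. c) (L1_mult h f)) v"
    using c[of f] c[of "L1_mult h f"] h'[of f] h'[of "L1_mult (\<lambda>_. c) f"]
    by eventually_elim simp
qed

lemma bounded_linear_L1_mult_damping:
  "a > 0 \<Longrightarrow> Re z \<ge> 0 \<Longrightarrow> bounded_linear (L1_mult (damping a z) :: pos L1 \<Rightarrow> pos L1)"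
  by (rule bounded_linear_L1_mult[OF damping_measurable, where C=1]) (rule norm_damping_le_1)

text \<open>
  On normalised nonnegative \<open>f\<close> the functions \<open>B f\<close> are nonnegative, normalised and form a relatively
  compact set, so that the gap on compact sets applies; it extends to all complex \<open>f\<close> because
  \<open>A e\<^sup>-\<^sup>2\<^sup>a\<^sup>z\<^sup>/\<^sup>v B\<close> is complex homogeneous.
\<close>

lemma compact_product_gap:
  assumes A: "stochastic_kernel A k" and B: "stochastic_kernel B l" "compact_operator B"
    and a: "a > 0"
  obtains c where "0 < c" "c \<le> 1" "\<And>z f. Re z \<ge> 0 \<Longrightarrow>
      norm (A (L1_mult (damping a z) (B f))) \<le> (1 - c * min 1 ((norm z)\<^sup>2)) * norm f"
proof -
  interpret A: stochastic_kernel A k by fact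
  interpret B: stochastic_kernel B l by fact
  let ?S = "B ` {f. L1_nonneg f \<and> norm f = 1}"
  have "?S \<subseteq> closure (B ` cball 0 1)"
    using closure_subset[of "B ` cball 0 1"] by auto
  moreover have "compact (closure (B ` cball 0 1))"
    using B(2) by (simp add: compact_operator_def)
  ultimately have comp: "compact (closure ?S)"
    by (rule compact_closure_subset[rotated])
  have S: "norm g = 1" "L1_nonneg g" if "g \<in> ?S" for g
    using that B.norm_nonneg B.nonneg by auto
  obtain c where c: "0 < c" "c \<le> 1"
    and gap: "\<And>z g. Re z \<ge> 0 \<Longrightarrow> g \<in> ?S \<Longrightarrow>
      norm (A (L1_mult (damping a z) g)) \<le> 1 - c * min 1 ((norm z)\<^sup>2)"
    using A.damped_gap[OF a comp S] by blast
  show ?thesis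
  proof (rule that[OF c])
    fix z :: complex and f :: "pos L1" assume z: "Re z \<ge> 0"
    let ?T = "\<lambda>f. A (L1_mult (damping a z) (B f))"
    have T: "bounded_linear ?T"
      by (rule bounded_linear_compose[OF A.linear
            bounded_linear_compose[OF bounded_linear_L1_mult_damping[OF a z] B.linear]])
    interpret T: bounded_linear ?T by (rule T)
    show "norm (?T f) \<le> (1 - c * min 1 ((norm z)\<^sup>2)) * norm f"
    proof (rule bound_from_positive_cone[OF T])
      fix u :: complex and f :: "pos L1"
      have "?T (L1_mult (\<lambda>_. u) f) = L1_mult (\<lambda>_. u) (?T f)"
        using L1_mult_commute[OF damping_measurable norm_damping_le_1[OF a z]]
        by (simp add: A.complex_homogeneous B.complex_homogeneous)
      then show "norm (?T (L1_mult (\<lambda>_. u) f)) \<le> norm u * norm (?T f)"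
        using rep_L1_mult(3)[where h="\<lambda>_. u" and C="norm u" and f="?T f"] by simp
    next
      fix f :: "pos L1" assume f: "L1_nonneg f"
      show "norm (?T f) \<le> (1 - c * min 1 ((norm z)\<^sup>2)) * norm f"
      proof (cases "f = 0")
        case True
        then show ?thesis by (simp add: T.zero)
      next
        case False
        define f1 where "f1 = (1 / norm f) *\<^sub>R f"
        have "L1_nonneg f1"
          using f rep_L1_scaleR[of "1 / norm f" f] unfolding L1_nonneg_def f1_def
          by eventually_elim (simp add: complex_nonneg_Reals_iff)
        moreover have "norm f1 = 1" using False by (simp add: f1_def)
        ultimately have "norm (?T f1) \<le> 1 - c * min 1 ((norm z)\<^sup>2)"
          by (intro gap z) auto
        then have "norm f * norm (?T f1) \<le> norm f * (1 - c * min 1 ((norm z)\<^sup>2))"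
          by (rule mult_left_mono) simp
        moreover have "?T f = norm f *\<^sub>R ?T f1"
          unfolding T.scaleR[symmetric] f1_def using False by simp
        ultimately show ?thesis
          by (simp add: mult.commute)
      qed
    qed
  qed
qed

text \<open>
  Of the four terms of the product only the one with both \<open>A\<close> and \<open>B\<close> is better than a
  contraction, and it carries the weight \<open>\<beta>1 * \<beta>2\<close>.
\<close>

lemma convex_product_bound:
  fixes A B E :: "'a::real_normed_vector \<Rightarrow> 'a"
  assumes A: "bounded_linear A" "\<And>f. norm (A f) \<le> norm f"
    and B: "\<And>f. norm (B f) \<le> norm f"
    and E: "bounded_linear E" "\<And>f. norm (E f) \<le> norm f"
    and AEB: "norm (A (E (B f))) \<le> (1 - \<delta>) * norm f"
    and w: "\<alpha>1 \<ge> 0" "\<beta>1 \<ge> 0" "\<alpha>1 + \<beta>1 = 1" "\<alpha>2 \<ge> 0" "\<beta>2 \<ge> 0" "\<alpha>2 + \<beta>2 = 1"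
  defines "g \<equiv> E (\<alpha>2 *\<^sub>R f + \<beta>2 *\<^sub>R B f)"
  shows "norm (\<alpha>1 *\<^sub>R g + \<beta>1 *\<^sub>R A g) \<le> (1 - \<beta>1 * \<beta>2 * \<delta>) * norm f"
proof -
  interpret A: bounded_linear A by fact
  interpret E: bounded_linear E by fact
  have "\<alpha>1 *\<^sub>R g + \<beta>1 *\<^sub>R A g = (\<alpha>1 * \<alpha>2) *\<^sub>R E f + (\<alpha>1 * \<beta>2) *\<^sub>R E (B f) +
      (\<beta>1 * \<alpha>2) *\<^sub>R A (E f) + (\<beta>1 * \<beta>2) *\<^sub>R A (E (B f))"
    by (simp add: g_def A.add A.scaleR E.add E.scaleR algebra_simps)
  also have "norm \<dots> \<le> (\<alpha>1 * \<alpha>2) * norm f + (\<alpha>1 * \<beta>2) * norm f + (\<beta>1 * \<alpha>2) * norm f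
      + (\<beta>1 * \<beta>2) * ((1 - \<delta>) * norm f)"
    using w AEB A(2) B E(2)
    by (intro norm_triangle_le add_mono) (auto intro!: mult_left_mono intro: order_trans)
  also have "\<dots> = ((\<alpha>1 + \<beta>1) * (\<alpha>2 + \<beta>2) - \<beta>1 * \<beta>2 * \<delta>) * norm f"
    by (simp add: algebra_simps)
  finally show ?thesis using w by simp
qed

section \<open>Consequences of a uniform gap\<close>

text \<open>
  A single estimate for both regimes: the gap is quadratic near \<open>0\<close> and constant away from it.
\<close>

definition uniform_gap_family :: "real \<Rightarrow> (complex \<Rightarrow> 'b::real_normed_vector \<Rightarrow> 'b) \<Rightarrow> bool"
  where "uniform_gap_family c F \<longleftrightarrow> 0 < c \<and> c \<le> 1 \<and>
    (\<forall>z f. Re z \<ge> 0 \<longrightarrow> norm (F z f) \<le> (1 - c * min 1 ((norm z)\<^sup>2)) * norm f)"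

lemma uniform_gap_familyI:
  assumes "0 < b" "b \<le> 1" "0 < c" "c \<le> 1"
    "\<And>z f. Re z \<ge> 0 \<Longrightarrow> norm (F z f) \<le> (1 - b * (c * min 1 ((norm z)\<^sup>2))) * norm f"
  shows "uniform_gap_family (b * c) F"
  unfolding uniform_gap_family_def using assms by (auto simp: mult_le_one mult.assoc)

lemma onorm_le_of_uniform_gap:
  assumes "uniform_gap_family c F" "Re z \<ge> 0"
  shows "onorm (F z) \<le> 1 - c * min 1 ((norm z)\<^sup>2)"
proof (rule onorm_bound)
  have "c * min 1 ((norm z)\<^sup>2) \<le> 1 * 1"
    using assms unfolding uniform_gap_family_def by (intro mult_mono) auto
  then show "0 \<le> 1 - c * min 1 ((norm z)\<^sup>2)" by simp
qed (use assms in \<open>auto simp: uniform_gap_family_def\<close>)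

lemma uniform_gap_after_contraction:
  assumes gap: "uniform_gap_family c F" and z: "Re z \<ge> 0" and fg: "norm g \<le> norm f"
  shows "norm (F z g) \<le> (1 - c * min 1 ((norm z)\<^sup>2)) * norm f"
proof -
  have "c * min 1 ((norm z)\<^sup>2) \<le> 1 * 1"
    using gap unfolding uniform_gap_family_def by (intro mult_mono) auto
  then have "(1 - c * min 1 ((norm z)\<^sup>2)) * norm g \<le> (1 - c * min 1 ((norm z)\<^sup>2)) * norm f"
    using fg by (intro mult_left_mono) auto
  then show ?thesis using gap z unfolding uniform_gap_family_def by (meson order_trans)
qed

lemma sup_norm_less_1_of_uniform_gap:
  assumes F: "uniform_gap_family c F" and \<eta>: "\<eta> > 0"
  shows "sup_norm_less_1 F (far_half_plane \<eta>)"
proof -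
  let ?q = "1 - c * min 1 (\<eta>\<^sup>2)"
  have q: "onorm (F z) \<le> ?q" if "z \<in> far_half_plane \<eta>" for z
  proof -
    have "\<eta>\<^sup>2 \<le> (norm z)\<^sup>2"
      using that \<eta> by (intro power_mono) (auto simp: far_half_plane_def)
    then have "c * min 1 (\<eta>\<^sup>2) \<le> c * min 1 ((norm z)\<^sup>2)"
      using F by (intro mult_left_mono) (auto simp: uniform_gap_family_def)
    then show ?thesis
      using onorm_le_of_uniform_gap[OF F, of z] that by (simp add: far_half_plane_def)
  qed
  have "of_real \<eta> \<in> far_half_plane \<eta>" using \<eta> by (simp add: far_half_plane_def)
  then have "far_half_plane \<eta> \<noteq> {}" by auto
  then have "(SUP z\<in>far_half_plane \<eta>. onorm (F z)) \<le> ?q" by (rule cSUP_least) (rule q)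
  moreover have "?q < 1" using F \<eta> by (simp add: uniform_gap_family_def)
  ultimately show ?thesis
    unfolding sup_norm_less_1_def using q by (auto intro!: bdd_aboveI2)
qed

lemma Im_square_le: "norm z \<le> 1 \<Longrightarrow> \<bar>Im z\<bar>\<^sup>2 \<le> min 1 ((norm z)\<^sup>2)"
  using power_mono[OF abs_Im_le_cmod[of z], of 2] power_mono[of "norm z" 1 2] by simp

lemma quadratic_gap_at_0_of_uniform_gap:
  assumes F: "uniform_gap_family c F"
  shows "quadratic_gap_at_0 F"
  unfolding quadratic_gap_at_0_def
proof (intro exI conjI)
  show "0 < c" using F by (simp add: uniform_gap_family_def)
  have "onorm (F z) \<le> 1 - c * \<bar>Im z\<bar>\<^sup>2" if "Re z \<ge> 0" "norm z < 1" for z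
  proof -
    have "c * \<bar>Im z\<bar>\<^sup>2 \<le> c * min 1 ((norm z)\<^sup>2)"
      using \<open>0 < c\<close> Im_square_le[of z] that by (intro mult_left_mono) auto
    then show ?thesis using onorm_le_of_uniform_gap[OF F that(1)] by linarith
  qed
  then show "\<forall>\<^sub>F z in at 0 within {z. Re z \<ge> 0}. onorm (F z) \<le> 1 - c * \<bar>Im z\<bar>\<^sup>2"
    unfolding eventually_at by (intro exI[of _ 1]) auto
qed

lemma resolvent_of_uniform_gap:
  fixes G :: "complex \<Rightarrow> 'd::velocity_domain L1 \<Rightarrow> 'd L1"
  assumes G: "\<forall>z. Re z \<ge> 0 \<longrightarrow> bounded_linear (G z) \<and> (\<forall>f. norm (G z f) \<le> norm f)"
    and gap: "uniform_gap_family c (\<lambda>z. G z ^^ 2)" and z: "Re z \<ge> 0" "z \<noteq> 0"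
  shows "has_resolvent_at_1 (G z)" "onorm (resolvent_at_1 (G z)) \<le> 2 / (c * min 1 ((norm z)\<^sup>2))"
proof -
  let ?q = "1 - c * min 1 ((norm z)\<^sup>2)"
  have c: "0 < c" "c \<le> 1" using gap by (auto simp: uniform_gap_family_def)
  have sq: "norm (G z (G z f)) \<le> ?q * norm f" for f
    using gap z unfolding uniform_gap_family_def by (simp add: numeral_2_eq_2)
  have "c * min 1 ((norm z)\<^sup>2) \<le> 1 * 1" using c by (intro mult_mono) auto
  then have q: "0 \<le> ?q" "?q < 1" using c z by auto
  have bl: "bounded_linear (G z)" and le: "norm (G z f) \<le> norm f" for f
    using G z(1) by auto
  note res = has_resolvent_at_1_of_square[OF bl le sq q]
  show "has_resolvent_at_1 (G z)" by (rule res(1))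
  show "onorm (resolvent_at_1 (G z)) \<le> 2 / (c * min 1 ((norm z)\<^sup>2))" using res(2) by simp
qed

lemma resolvents_bounded_of_uniform_gap:
  fixes G :: "complex \<Rightarrow> 'd::velocity_domain L1 \<Rightarrow> 'd L1"
  assumes G: "\<forall>z. Re z \<ge> 0 \<longrightarrow> bounded_linear (G z) \<and> (\<forall>f. norm (G z f) \<le> norm f)"
    and gap: "uniform_gap_family c (\<lambda>z. G z ^^ 2)" and \<eta>: "\<eta> > 0"
  shows "resolvents_bounded G (far_half_plane \<eta>)"
proof -
  have c: "0 < c" using gap by (auto simp: uniform_gap_family_def)
  have z: "Re z \<ge> 0" "z \<noteq> 0" "\<eta> \<le> norm z" if "z \<in> far_half_plane \<eta>" for z
    using that \<eta> by (auto simp: far_half_plane_def)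
  have "onorm (resolvent_at_1 (G z)) \<le> 2 / (c * min 1 (\<eta>\<^sup>2))" if "z \<in> far_half_plane \<eta>" for z
  proof -
    have "\<eta>\<^sup>2 \<le> (norm z)\<^sup>2" using z[OF that] \<eta> by (intro power_mono) auto
    then have "c * min 1 (\<eta>\<^sup>2) \<le> c * min 1 ((norm z)\<^sup>2)" using c by (intro mult_left_mono) auto
    moreover have "0 < c * min 1 (\<eta>\<^sup>2)" using c \<eta> by simp
    ultimately have "2 / (c * min 1 ((norm z)\<^sup>2)) \<le> 2 / (c * min 1 (\<eta>\<^sup>2))"
      by (intro frac_le) auto
    then show ?thesis using resolvent_of_uniform_gap(2)[OF G gap z(1,2)[OF that]] by simp
  qed
  then show ?thesis
    unfolding resolvents_bounded_def
    using resolvent_of_uniform_gap(1)[OF G gap] z by (auto intro!: bdd_aboveI2)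
qed

lemma resolvent_quadratic_at_0_of_uniform_gap:
  fixes G :: "complex \<Rightarrow> 'd::velocity_domain L1 \<Rightarrow> 'd L1"
  assumes G: "\<forall>z. Re z \<ge> 0 \<longrightarrow> bounded_linear (G z) \<and> (\<forall>f. norm (G z f) \<le> norm f)"
    and gap: "uniform_gap_family c (\<lambda>z. G z ^^ 2)"
  shows "resolvent_quadratic_at_0 G"
proof -
  have c: "0 < c" using gap by (auto simp: uniform_gap_family_def)
  note res = resolvent_of_uniform_gap[OF G gap]
  have "\<forall>\<^sub>F z in at 0 within {z. Re z \<ge> 0}. has_resolvent_at_1 (G z)"
    unfolding eventually_at by (intro exI[of _ 1]) (auto intro: res(1))
  moreover have "(\<lambda>z. onorm (resolvent_at_1 (G z)))
      \<in> O[at 0 within {z. Re z \<ge> 0 \<and> Im z \<noteq> 0}](\<lambda>z. 1 / \<bar>Im z\<bar>\<^sup>2)"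
  proof (rule bigoI[where c="2 / c"])
    have "norm (onorm (resolvent_at_1 (G z))) \<le> 2 / c * norm (1 / \<bar>Im z\<bar>\<^sup>2)"
      if z: "Re z \<ge> 0" "Im z \<noteq> 0" "norm z < 1" for z
    proof -
      have z0: "z \<noteq> 0" using z by auto
      have "0 \<le> onorm (resolvent_at_1 (G z))"
        using res(1)[OF z(1) z0] by (intro onorm_pos_le) (simp add: has_resolvent_at_1_def)
      moreover have "c * \<bar>Im z\<bar>\<^sup>2 \<le> c * min 1 ((norm z)\<^sup>2)"
        using c Im_square_le[of z] z by (intro mult_left_mono) auto
      then have "2 / (c * min 1 ((norm z)\<^sup>2)) \<le> 2 / (c * \<bar>Im z\<bar>\<^sup>2)"
        using c z by (intro frac_le) auto
      ultimately show ?thesis using res(2)[OF z(1) z0] by simp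
    qed
    then show "\<forall>\<^sub>F z in at 0 within {z. Re z \<ge> 0 \<and> Im z \<noteq> 0}.
        norm (onorm (resolvent_at_1 (G z))) \<le> 2 / c * norm (1 / \<bar>Im z\<bar>\<^sup>2)"
      unfolding eventually_at by (intro exI[of _ 1]) auto
  qed
  ultimately show ?thesis by (simp add: resolvent_quadratic_at_0_def)
qed

section \<open>The operator of the transport problem\<close>

lemma damping_double_L1:
  fixes f :: "pos L1"
  assumes a: "a > 0" and z: "Re z \<ge> 0"
  shows "L1_mult (damping a z) (L1_mult (damping a z) f) = L1_mult (damping (2 * a) z) f"
proof (rule L1_eqI)
  have r: "AE v in vpos. rep_L1 (L1_mult (damping b z) g) v = damping b z v * rep_L1 g v"
    if "b > 0" for b and g :: "pos L1"
    by (rule rep_L1_mult(2)[OF damping_measurable, where C=1]) (rule norm_damping_le_1[OF that z])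
  have d: "damping (2 * a) z v = damping a z v * damping a z v" for v
    unfolding damping_def by (simp add: exp_add[symmetric] add_divide_distrib[symmetric] algebra_simps)
  show "AE v in vpos. rep_L1 (L1_mult (damping a z) (L1_mult (damping a z) f)) v = rep_L1 (L1_mult (damping (2 * a) z) f) v"
    using r[OF a, of f] r[OF a, of "L1_mult (damping a z) f"] r[of "2 * a" f] a
    by (auto elim!: eventually_elim2 simp: d) 
qed

text \<open>
  Damping is even in the velocity and hence commutes with reflections. Inserting the identity
  \<open>reflect \<circ> reflect\<close> between the factors turns \<open>G\<^sub>\<lambda>\<close> into a product of operators on \<open>L\<^sup>1(0,1)\<close> alone,
  in which the reflections \<open>R\<^sub>i\<close> have become identities.
\<close>

lemma G_operator_eq:
  fixes K1 :: "neg L1 \<Rightarrow> pos L1" and K2 :: "pos L1 \<Rightarrow> neg L1"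
  assumes a: "a > 0" and z: "Re z \<ge> 0"
  defines "A \<equiv> \<lambda>f. K1 (reflect f)" and "B \<equiv> \<lambda>f. reflect (K2 f)"
    and "E \<equiv> L1_mult (damping a z) :: pos L1 \<Rightarrow> pos L1"
  shows "G_operator a (boundary_operator \<alpha>1 \<beta>1 K1) (boundary_operator \<alpha>2 \<beta>2 K2) z f =
    (let g = E (\<alpha>2 *\<^sub>R E f + \<beta>2 *\<^sub>R B (E f)) in \<alpha>1 *\<^sub>R g + \<beta>1 *\<^sub>R A g)"
proof -
  interpret R: bounded_linear "reflect :: neg L1 \<Rightarrow> pos L1" by (rule reflect_neg.bounded_linear_reflect)
  let ?h = "boundary_operator \<alpha>2 \<beta>2 K2 (E f)"
  have dm: "damping a z \<in> borel_measurable (vmeasure TYPE('d::velocity_domain))"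
    unfolding damping_def vmeasure_def by (intro measurable_restrict_space1) measurable
  have "reflect ?h = \<alpha>2 *\<^sub>R E f + \<beta>2 *\<^sub>R B (E f)"
    by (simp add: boundary_operator_def R.add R.scaleR reflect_pos.reflect_reflect B_def)
  moreover have "reflect (L1_mult (damping a z) ?h) = E (reflect ?h)"
    unfolding E_def
    by (rule reflect_neg.reflect_mult[OF dm dm norm_damping_le_1[OF a z]]) (simp add: damping_def)
  moreover have "boundary_operator \<alpha>1 \<beta>1 K1 g = \<alpha>1 *\<^sub>R reflect g + \<beta>1 *\<^sub>R A (reflect g)" for g
    by (simp add: boundary_operator_def A_def reflect_neg.reflect_reflect)
  ultimately show ?thesis
    by (simp add: G_operator_def E_def Let_def)
qed

locale transport_boundary =
  fixes a \<alpha>1 \<beta>1 \<alpha>2 \<beta>2 :: real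
    and K1 :: "neg L1 \<Rightarrow> pos L1" and K2 :: "pos L1 \<Rightarrow> neg L1"
    and k1 k2 :: "real \<Rightarrow> real \<Rightarrow> real"
  assumes a: "a > 0"
    and weights: "\<alpha>1 \<ge> 0" "\<beta>1 \<ge> 0" "\<alpha>1 + \<beta>1 = 1" "\<alpha>2 \<ge> 0" "\<beta>2 \<ge> 0" "\<alpha>2 + \<beta>2 = 1"
    and K1: "stochastic K1" "integral_operator k1 K1" "compact_operator K1"
    and K2: "stochastic K2" "integral_operator k2 K2" "compact_operator K2"
begin

definition G :: "complex \<Rightarrow> pos L1 \<Rightarrow> pos L1"
  where "G = G_operator a (boundary_operator \<alpha>1 \<beta>1 K1) (boundary_operator \<alpha>2 \<beta>2 K2)"

definition A :: "pos L1 \<Rightarrow> pos L1" where "A = (\<lambda>f. K1 (reflect f))"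
definition B :: "pos L1 \<Rightarrow> pos L1" where "B = (\<lambda>f. reflect (K2 f))"

definition E :: "real \<Rightarrow> complex \<Rightarrow> pos L1 \<Rightarrow> pos L1"
  where "E b z = L1_mult (damping b z)"

definition P1 :: "pos L1 \<Rightarrow> pos L1" where "P1 f = \<alpha>1 *\<^sub>R f + \<beta>1 *\<^sub>R A f"
definition P2 :: "pos L1 \<Rightarrow> pos L1" where "P2 f = \<alpha>2 *\<^sub>R f + \<beta>2 *\<^sub>R B f"

sublocale A: stochastic_kernel A "\<lambda>v w. k1 v (- w)"
  unfolding A_def by (rule stochastic_kernel_comp_reflect[OF K1(1,2)])

sublocale B: stochastic_kernel B "\<lambda>v w. k2 (- v) w"
  unfolding B_def by (rule stochastic_kernel_reflect_comp[OF K2(1,2)])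

lemma compact_A: "compact_operator A"
  unfolding A_def by (rule compact_operator_comp_reflect[OF K1(3)])

lemma compact_B: "compact_operator B"
  unfolding B_def by (rule compact_operator_reflect_comp[OF K2(3)])

lemma G_eq: "Re z \<ge> 0 \<Longrightarrow> G z f = P1 (E a z (P2 (E a z f)))"
  using G_operator_eq[OF a, of z \<alpha>1 \<beta>1 K1 \<alpha>2 \<beta>2 K2 f]
  by (simp add: G_def P1_def P2_def A_def B_def E_def Let_def)

lemma E_linear: "b > 0 \<Longrightarrow> Re z \<ge> 0 \<Longrightarrow> bounded_linear (E b z)"
  unfolding E_def by (rule bounded_linear_L1_mult_damping)

lemma E_le: "b > 0 \<Longrightarrow> Re z \<ge> 0 \<Longrightarrow> norm (E b z f) \<le> norm f"
  unfolding E_def by (rule norm_L1_mult_damping_le)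

lemma E_double: "Re z \<ge> 0 \<Longrightarrow> E a z (E a z f) = E (2 * a) z f"
  unfolding E_def by (rule damping_double_L1[OF a])

lemma G_linear: "Re z \<ge> 0 \<Longrightarrow> bounded_linear (G z)"
proof -
  assume z: "Re z \<ge> 0"
  have "bounded_linear P1" "bounded_linear P2"
    unfolding P1_def[abs_def] P2_def[abs_def]
    by (intro bounded_linear_add bounded_linear_const_scaleR bounded_linear_ident A.linear B.linear)+
  then have "bounded_linear (\<lambda>f. P1 (E a z (P2 (E a z f))))"
    by (rule bounded_linear_compose[OF _ bounded_linear_compose[OF E_linear[OF a z]
          bounded_linear_compose[OF _ E_linear[OF a z]]]])
  moreover have "G z = (\<lambda>f. P1 (E a z (P2 (E a z f))))"
    using G_eq[OF z] by (rule ext)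
  ultimately show ?thesis by simp
qed

lemma G_contraction: "Re z \<ge> 0 \<Longrightarrow> norm (G z f) \<le> norm f"
proof -
  assume z: "Re z \<ge> 0"
  have "norm (P1 (E a z (P2 (E a z f)))) \<le> (1 - \<beta>1 * \<beta>2 * 0) * norm (E a z f)"
    unfolding P1_def P2_def
  proof (rule convex_product_bound[OF A.linear A.norm_le B.norm_le E_linear[OF a z] E_le[OF a z] _ weights])
    show "norm (A (E a z (B (E a z f)))) \<le> (1 - 0) * norm (E a z f)"
      using A.norm_le[of "E a z (B (E a z f))"] E_le[OF a z, of "B (E a z f)"] B.norm_le[of "E a z f"] by simp
  qed
  then show ?thesis using E_le[OF a z, of f] G_eq[OF z] by simp
qed

lemma mixed_gap:
  assumes A': "stochastic_kernel A' k" "compact_operator A'"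
    and B': "stochastic_kernel B' l" "compact_operator B'"
    and b: "b > 0"
    and w: "\<gamma>1 \<ge> 0" "\<delta>1 > 0" "\<gamma>1 + \<delta>1 = 1" "\<gamma>2 \<ge> 0" "\<delta>2 > 0" "\<gamma>2 + \<delta>2 = 1"
  shows "\<exists>c. uniform_gap_family c (\<lambda>z f. let g = E b z (\<gamma>2 *\<^sub>R f + \<delta>2 *\<^sub>R B' f) in \<gamma>1 *\<^sub>R g + \<delta>1 *\<^sub>R A' g)"
proof -
  interpret A': stochastic_kernel A' k by fact
  interpret B': stochastic_kernel B' l by fact
  obtain c where c: "0 < c" "c \<le> 1" and gap: "\<And>z f. Re z \<ge> 0 \<Longrightarrow>
      norm (A' (E b z (B' f))) \<le> (1 - c * min 1 ((norm z)\<^sup>2)) * norm f"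
    using compact_product_gap[OF A'(1) B' b] unfolding E_def by blast
  show ?thesis
  proof (intro exI[of _ "\<delta>1 * \<delta>2 * c"] uniform_gap_familyI[OF _ _ c])
    show "0 < \<delta>1 * \<delta>2" using w by simp
    show "\<delta>1 * \<delta>2 \<le> 1" using w by (intro mult_le_one) auto
    fix z :: complex and f :: "pos L1" assume z: "Re z \<ge> 0"
    show "norm (let g = E b z (\<gamma>2 *\<^sub>R f + \<delta>2 *\<^sub>R B' f) in \<gamma>1 *\<^sub>R g + \<delta>1 *\<^sub>R A' g)
        \<le> (1 - \<delta>1 * \<delta>2 * (c * min 1 ((norm z)\<^sup>2))) * norm f"
      unfolding Let_def
      using w by (intro convex_product_bound[OF A'.linear A'.norm_le B'.norm_le E_linear[OF b z] E_le[OF b z] gap[OF z]]) auto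
  qed
qed

lemma gap_G:
  assumes "\<beta>1 > 0" "\<beta>2 > 0"
  shows "\<exists>c. uniform_gap_family c G"
proof -
  obtain c where c: "uniform_gap_family c (\<lambda>z f. P1 (E a z (P2 f)))"
    using mixed_gap[OF A.stochastic_kernel_axioms compact_A B.stochastic_kernel_axioms compact_B a
        weights(1) assms(1) weights(3,4) assms(2) weights(6)]
    by (auto simp: P1_def P2_def Let_def)
  then have "uniform_gap_family c G"
    using uniform_gap_after_contraction[OF c _ E_le[OF a]] by (simp add: uniform_gap_family_def G_eq)
  then show ?thesis by blast
qed

text \<open>
  If one of the walls only reflects, a single passage contains no product of two smoothing
  operators, but two passages do: \<open>G\<^sub>\<lambda>\<^sup>2\<close> contains \<open>A e\<^sup>-\<^sup>4\<^sup>a\<^sup>\<lambda>\<^sup>/\<^sup>v A\<close>, respectively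
  \<open>B e\<^sup>-\<^sup>4\<^sup>a\<^sup>\<lambda>\<^sup>/\<^sup>v B\<close>, with the damping of two adjacent crossings combined.
\<close>

lemma gap_G_square:
  assumes "\<beta>1 + \<beta>2 > 0"
  shows "\<exists>c. uniform_gap_family c (\<lambda>z. G z ^^ 2)"
proof -
  have sq: "(G z ^^ 2) f = G z (G z f)" for z f by (simp add: numeral_2_eq_2)
  have a2: "2 * a > 0" using a by simp
  consider "\<beta>1 > 0" "\<beta>2 > 0" | "\<beta>1 > 0" "\<beta>2 = 0" | "\<beta>1 = 0" "\<beta>2 > 0"
    using assms weights(2,5) by linarith
  then show ?thesis
  proof cases
    case 1
    then obtain c where c: "uniform_gap_family c G" using gap_G by blast
    then have "uniform_gap_family c (\<lambda>z. G z ^^ 2)"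
      using uniform_gap_after_contraction[OF c _ G_contraction] by (simp add: uniform_gap_family_def sq)
    then show ?thesis by blast
  next
    case 2
    then have P2: "P2 f = f" for f unfolding P2_def using weights(6) by simp
    obtain c where c: "uniform_gap_family c (\<lambda>z f. P1 (E (2 * a) z (P1 f)))"
      using mixed_gap[OF A.stochastic_kernel_axioms compact_A A.stochastic_kernel_axioms compact_A a2
          weights(1) 2(1) weights(3,1) 2(1) weights(3)]
      by (auto simp: P1_def Let_def)
    have "G z (G z f) = P1 (E (2 * a) z (P1 (E (2 * a) z f)))" if "Re z \<ge> 0" for z f
      using that by (simp add: G_eq P2 E_double)
    then have "uniform_gap_family c (\<lambda>z. G z ^^ 2)"
      using uniform_gap_after_contraction[OF c _ E_le[OF a2]] c by (simp add: uniform_gap_family_def sq)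
    then show ?thesis by blast
  next
    case 3
    then have P1: "P1 f = f" for f unfolding P1_def using weights(3) by simp
    obtain c where c: "uniform_gap_family c (\<lambda>z f. P2 (E (2 * a) z (P2 f)))"
      using mixed_gap[OF B.stochastic_kernel_axioms compact_B B.stochastic_kernel_axioms compact_B a2
          weights(4) 3(2) weights(6,4) 3(2) weights(6)]
      by (auto simp: P2_def Let_def)
    have "norm (G z (G z f)) \<le> (1 - c * min 1 ((norm z)\<^sup>2)) * norm f" if z: "Re z \<ge> 0" for z f
    proof -
      have "norm (G z (G z f)) \<le> norm (P2 (E (2 * a) z (P2 (E a z f))))"
        using z E_le[OF a z] by (simp add: G_eq P1 E_double)
      also have "\<dots> \<le> (1 - c * min 1 ((norm z)\<^sup>2)) * norm f"
        by (rule uniform_gap_after_contraction[OF c z E_le[OF a z]])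
      finally show ?thesis .
    qed
    then have "uniform_gap_family c (\<lambda>z. G z ^^ 2)"
      using c by (simp add: uniform_gap_family_def sq)
    then show ?thesis by blast
  qed
qed

end

theorem theorem23:
  fixes a \<alpha>1 \<beta>1 \<alpha>2 \<beta>2 :: real
    and K1 :: "neg L1 \<Rightarrow> pos L1" and K2 :: "pos L1 \<Rightarrow> neg L1"
    and k1 k2 :: "real \<Rightarrow> real \<Rightarrow> real"
    and G :: "complex \<Rightarrow> pos L1 \<Rightarrow> pos L1"
  assumes "a > 0"
    and "\<alpha>1 \<ge> 0" "\<beta>1 \<ge> 0" "\<alpha>1 + \<beta>1 = 1"
    and "\<alpha>2 \<ge> 0" "\<beta>2 \<ge> 0" "\<alpha>2 + \<beta>2 = 1"
    and "stochastic K1" "weakly_compact_operator K1" "integral_operator k1 K1"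
    and "stochastic K2" "weakly_compact_operator K2" "integral_operator k2 K2"
    and "G = G_operator a (boundary_operator \<alpha>1 \<beta>1 K1) (boundary_operator \<alpha>2 \<beta>2 K2)"
    and "compact_operator K1" "compact_operator K2"
    and "\<beta>1 + \<beta>2 > 0"
  shows
    "(\<beta>1 > 0 \<and> \<beta>2 > 0 \<longrightarrow>
        (sections_ess_bounded TYPE(pos) TYPE(neg) k1 \<longrightarrow>
          (\<forall>\<eta>>0. sup_norm_less_1 G (far_half_plane \<eta>))) \<and>
        (continuous_kernel TYPE(pos) TYPE(neg) k1 \<and> continuous_kernel TYPE(neg) TYPE(pos) k2 \<and>
         inv_square_product_bounded K1 K2 \<longrightarrow>
          quadratic_gap_at_0 G)) \<and>
     (\<beta>1 > 0 \<and> \<beta>2 = 0 \<longrightarrow>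
        (sections_ess_bounded TYPE(pos) TYPE(neg) k1 \<longrightarrow>
          (\<forall>\<eta>>0. sup_norm_less_1 (\<lambda>z. G z ^^ 2) (far_half_plane \<eta>))) \<and>
        (continuous_kernel TYPE(pos) TYPE(neg) k1 \<and>
         inv_square_product_bounded K1 (reflect \<circ> K1 :: neg L1 \<Rightarrow> neg L1) \<longrightarrow>
          quadratic_gap_at_0 (\<lambda>z. G z ^^ 2))) \<and>
     (\<beta>1 = 0 \<and> \<beta>2 > 0 \<longrightarrow>
        (sections_ess_bounded TYPE(neg) TYPE(pos) k2 \<longrightarrow>
          (\<forall>\<eta>>0. sup_norm_less_1 (\<lambda>z. G z ^^ 2) (far_half_plane \<eta>))) \<and>
        (continuous_kernel TYPE(neg) TYPE(pos) k2 \<and>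
         inv_square_product_bounded K2 (reflect \<circ> K2 :: pos L1 \<Rightarrow> pos L1) \<longrightarrow>
          quadratic_gap_at_0 (\<lambda>z. G z ^^ 2))) \<and>
     ((\<beta>1 > 0 \<and> \<beta>2 > 0 \<and> sections_ess_bounded TYPE(pos) TYPE(neg) k1) \<or>
      (\<beta>1 > 0 \<and> \<beta>2 = 0 \<and> sections_ess_bounded TYPE(pos) TYPE(neg) k1) \<or>
      (\<beta>1 = 0 \<and> \<beta>2 > 0 \<and> sections_ess_bounded TYPE(neg) TYPE(pos) k2) \<longrightarrow>
        (\<forall>\<eta>>0. resolvents_bounded G (far_half_plane \<eta>))) \<and>
     ((\<beta>1 > 0 \<and> \<beta>2 > 0 \<and>
       continuous_kernel TYPE(pos) TYPE(neg) k1 \<and> continuous_kernel TYPE(neg) TYPE(pos) k2 \<and>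
       inv_square_product_bounded K1 K2) \<or>
      (\<beta>1 > 0 \<and> \<beta>2 = 0 \<and> continuous_kernel TYPE(pos) TYPE(neg) k1 \<and>
       inv_square_product_bounded K1 (reflect \<circ> K1 :: neg L1 \<Rightarrow> neg L1)) \<or>
      (\<beta>1 = 0 \<and> \<beta>2 > 0 \<and> continuous_kernel TYPE(neg) TYPE(pos) k2 \<and>
       inv_square_product_bounded K2 (reflect \<circ> K2 :: pos L1 \<Rightarrow> pos L1)) \<longrightarrow>
        resolvent_quadratic_at_0 G)"
proof -
  interpret T: transport_boundary a \<alpha>1 \<beta>1 \<alpha>2 \<beta>2 K1 K2 k1 k2
    by standard (use assms in auto)
  have G: "G = T.G" using assms by (simp add: T.G_def)
  have contr: "\<forall>z. Re z \<ge> 0 \<longrightarrow> bounded_linear (G z) \<and> (\<forall>f. norm (G z f) \<le> norm f)"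
    unfolding G using T.G_linear T.G_contraction by blast
  obtain c where sq: "uniform_gap_family c (\<lambda>z. G z ^^ 2)"
    unfolding G using T.gap_G_square assms by blast
  have both: "(\<forall>\<eta>>0. sup_norm_less_1 G (far_half_plane \<eta>)) \<and> quadratic_gap_at_0 G" if "\<beta>1 > 0" "\<beta>2 > 0"
    unfolding G using T.gap_G[OF that] sup_norm_less_1_of_uniform_gap quadratic_gap_at_0_of_uniform_gap by blast
  have "\<forall>\<eta>>0. sup_norm_less_1 (\<lambda>z. G z ^^ 2) (far_half_plane \<eta>)" "quadratic_gap_at_0 (\<lambda>z. G z ^^ 2)"
    using sup_norm_less_1_of_uniform_gap[OF sq] quadratic_gap_at_0_of_uniform_gap[OF sq] by auto
  moreover have "\<forall>\<eta>>0. resolvents_bounded G (far_half_plane \<eta>)" "resolvent_quadratic_at_0 G"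
    using resolvents_bounded_of_uniform_gap[OF contr sq] resolvent_quadratic_at_0_of_uniform_gap[OF contr sq]
    by auto
  ultimately show ?thesis using both by simp
qed

end
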